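(* Let $T$ be a nontrivial tree (a finite tree of order at least two). Then $\gamma_{t}^{oi}(\mathtt{S}(T))=\frac{4n(T)-l(T)+s(T)-2}{3}$ if and only if $T\in\mathcal{T}$.
   Context: All graphs are finite, simple and connected. $n(G)$ is the number of vertices of $G$, $N_G(v)$ is the open neighborhood of $v$, and $P_r$ is the path on $r$ vertices. A leaf of $G$ is a vertex $v$ with $|N_G(v)|=1$; a support vertex is a vertex adjacent to a leaf. $\mathcal{L}(G)$ and $\mathcal{S}(G)$ are the sets of leaves and of support vertices, $l(G)=|\mathcal{L}(G)|$, $s(G)=|\mathcal{S}(G)|$. Convention: in $P_2$, one of the two vertices is taken to be a support vertex and the other a leaf (so $l(P_2)=s(P_2)=1$). $\mathcal{S}_s(G)=\{v\in\mathcal{S}(G): |N_G(v)\cap\mathcal{L}(G)|\ge 2\}$ (strong support vertices); $\mathcal{L}_s(G)=\{v\in\mathcal{L}(G): |N_G(v)\cap\mathcal{S}_s(G)|=1\}$ (strong leaves); $\mathcal{L}_w(G)=\mathcal{L}(G)\setminus\mathcal{L}_s(G)$ (weak leaves). A total outer-independent dominating set (TOIDS) of a nontrivial connected graph $G$ is a set $D\subseteq V(G)$ such that every vertex of $G$ is adjacent to at least one vertex of $D$ and $V(G)\setminus D$ is an independent set. $\gamma_t^{oi}(G)$ is the minimum cardinality of a TOIDS of $G$. The subdivision graph $\mathtt{S}(G)$ is obtained from $G$ by subdividing every edge exactly once. Attaching a path $P_r$ to a vertex $v$ of $G$ means adding a disjoint copy of $P_r$ and joining $v$ by an edge to a leaf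 (end vertex) of $P_r$ (to its only vertex if $r=1$). For an integer $r\ge 2$, $Q_r$ is the tree obtained from one copy of $P_1$ and $r$ disjoint copies of $P_3$ by joining, with an edge, one leaf of each copy of $P_3$ to the vertex of $P_1$; the vertex of $P_1$ is the central vertex of $Q_r$. $\mathcal{T}$ is the family of trees $T$ (up to isomorphism) that can be obtained from a sequence of trees $T_0,\ldots,T_k=T$ with $k\ge 0$, $T_0=P_2$, and, if $k\ge 1$, for each $i\in\{1,\ldots,k\}$ the tree $T_i$ is obtained from $T'=T_{i-1}$ by one of the following operations. Operation $O_1$: attach a path $P_1$ to a vertex in $\mathcal{S}(T')$. Operation $O_2$: attach a path $P_3$ to a vertex in $\mathcal{S}(T')\cup\mathcal{L}_w(T')$. Operation $O_3$: add a (disjoint) tree $Q_r$, for some integer $r\ge 2$, and identify its central vertex with a vertex in $\mathcal{L}_w(T')$. *)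

theory Defs
  imports Complex_Main "Graph_Theory.Digraph_Isomorphism"
begin

text \<open>
  A finite simple graph is a \<^locale>\<open>pair_graph\<close>: a finite, loop-free digraph whose set of arcs
  (pairs of vertices) is symmetric; each edge is represented by its two arcs.
\<close>

definition nbrs :: "'a pair_pre_digraph \<Rightarrow> 'a \<Rightarrow> 'a set" where
  "nbrs G v = {u. (v, u) \<in> parcs G}"

text \<open>
  \<^const>\<open>Digraph_Component.tree\<close> cannot be used here: in a symmetric digraph every edge gives a
  cycle \<open>a, b, a\<close> of length 2. The cycles of the undirected graph are those of length at least 3.
\<close>

definition is_tree :: "'a pair_pre_digraph \<Rightarrow> bool" where
  "is_tree G \<longleftrightarrow> pair_graph G \<and> Digraph_Component.connected (with_proj G) \<and>
     \<not> (\<exists>p. pre_digraph.cycle (with_proj G) p \<and> 3 \<le> length p)"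


subsection \<open>Leaves and support vertices\<close>

text \<open>
  A connected graph with two vertices is \<open>P\<^sub>2\<close>. By convention one of its vertices, here an
  arbitrary but fixed one, is its only leaf; the other one is then its only support vertex.
\<close>

definition leaves :: "'a pair_pre_digraph \<Rightarrow> 'a set" where
  "leaves G = (if card (pverts G) = 2 then {SOME v. v \<in> pverts G}
               else {v \<in> pverts G. card (nbrs G v) = 1})"

definition support :: "'a pair_pre_digraph \<Rightarrow> 'a set" where
  "support G = {v \<in> pverts G. \<exists>u \<in> leaves G. u \<in> nbrs G v}"

definition strong_support :: "'a pair_pre_digraph \<Rightarrow> 'a set" where
  "strong_support G = {v \<in> support G. 2 \<le> card (nbrs G v \<inter> leaves G)}"

definition strong_leaves :: "'a pair_pre_digraph \<Rightarrow> 'a set" where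
  "strong_leaves G = {v \<in> leaves G. card (nbrs G v \<inter> strong_support G) = 1}"

definition weak_leaves :: "'a pair_pre_digraph \<Rightarrow> 'a set" where
  "weak_leaves G = leaves G - strong_leaves G"


subsection \<open>Total outer-independent domination\<close>

definition is_TOIDS :: "'a pair_pre_digraph \<Rightarrow> 'a set \<Rightarrow> bool" where
  "is_TOIDS G D \<longleftrightarrow> D \<subseteq> pverts G \<and> (\<forall>v \<in> pverts G. \<exists>u \<in> D. u \<in> nbrs G v) \<and>
     (\<forall>u \<in> pverts G - D. \<forall>v \<in> pverts G - D. (u, v) \<notin> parcs G)"

definition gamma_t_oi :: "'a pair_pre_digraph \<Rightarrow> nat" where
  "gamma_t_oi G = Min (card ` {D. is_TOIDS G D})"


subsection \<open>The subdivision graph\<close>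

text \<open>The new vertex that subdivides the edge between \<open>u\<close> and \<open>v\<close> is \<open>Inr {u, v}\<close>.\<close>

definition subdivision_graph :: "'a pair_pre_digraph \<Rightarrow> ('a + 'a set) pair_pre_digraph" where
  "subdivision_graph G =
     \<lparr> pverts = Inl ` pverts G \<union> {Inr {u, v} | u v. (u, v) \<in> parcs G},
       parcs = {(Inl u, Inr {u, v}) | u v. (u, v) \<in> parcs G}
             \<union> {(Inr {u, v}, Inl u) | u v. (u, v) \<in> parcs G} \<rparr>"


subsection \<open>The family of trees\<close>

text \<open>Path graphs and attachment are meaningful for lists of distinct vertices; an attached path
  must also be disjoint from the graph and nonempty. It is joined by its end vertex \<open>hd ws\<close>.\<close>

definition path_graph :: "'a list \<Rightarrow> 'a pair_pre_digraph" where
  "path_graph ws = \<lparr> pverts = set ws,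
     parcs = set (zip ws (tl ws)) \<union> (set (zip ws (tl ws)))\<inverse> \<rparr>"

definition attach_path :: "'a pair_pre_digraph \<Rightarrow> 'a \<Rightarrow> 'a list \<Rightarrow> 'a pair_pre_digraph" where
  "attach_path G v ws = \<lparr> pverts = pverts G \<union> pverts (path_graph ws),
     parcs = parcs G \<union> parcs (path_graph ws) \<union> {(v, hd ws), (hd ws, v)} \<rparr>"

text \<open>\<open>is_Q r c Q\<close>: \<open>Q\<close> is a copy of \<open>Q\<^sub>r\<close> with central vertex \<open>c\<close>.\<close>

definition is_Q :: "nat \<Rightarrow> 'a \<Rightarrow> 'a pair_pre_digraph \<Rightarrow> bool" where
  "is_Q r c Q \<longleftrightarrow> (\<exists>ps. length ps = r \<and> (\<forall>p \<in> set ps. length p = 3) \<and> distinct (c # concat ps) \<and>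
     Q = foldr (\<lambda>p H. attach_path H c p) ps (path_graph [c]))"

text \<open>
  The family is closed under isomorphism explicitly. This rule is not redundant: the choice of the
  leaf of a concrete \<open>P\<^sub>2\<close> is fixed, so \<open>O1\<close> and \<open>O3\<close> alone might miss some copies of the trees
  they produce from it.

  In \<open>O3\<close>, adding a disjoint \<open>Q\<^sub>r\<close> and identifying its central vertex with \<open>v\<close> amounts to the
  union with a copy of \<open>Q\<^sub>r\<close> centred at \<open>v\<close> that has only \<open>v\<close> in common with \<open>T\<close>.
\<close>

inductive_set tree_family :: "'a pair_pre_digraph set" where
  P2: "u \<noteq> v \<Longrightarrow> path_graph [u, v] \<in> tree_family"
| O1: "\<lbrakk>T \<in> tree_family; v \<in> support T; w \<notin> pverts T\<rbrakk>
       \<Longrightarrow> attach_path T v [w] \<in> tree_family"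
| O2: "\<lbrakk>T \<in> tree_family; v \<in> support T \<union> weak_leaves T;
        length ws = 3; distinct ws; set ws \<inter> pverts T = {}\<rbrakk>
       \<Longrightarrow> attach_path T v ws \<in> tree_family"
| O3: "\<lbrakk>T \<in> tree_family; v \<in> weak_leaves T; 2 \<le> r; is_Q r v Q; pverts Q \<inter> pverts T = {v}\<rbrakk>
       \<Longrightarrow> \<lparr> pverts = pverts T \<union> pverts Q, parcs = parcs T \<union> parcs Q \<rparr> \<in> tree_family"
| iso: "\<lbrakk>T \<in> tree_family; digraph_iso (with_proj T) (with_proj T')\<rbrakk> \<Longrightarrow> T' \<in> tree_family"

end

theory Submission
  imports Defs
begin

text \<open>
  Upper bound: root the tree at a support vertex \<open>r\<close>. For each residue \<open>j\<close> modulo 3, delete from the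
  set of original vertices the leaves and the inner vertices (neither leaf nor support vertex) on the levels
  congruent to \<open>j\<close>, and add all edges at the deleted vertices together with a few edges
  that cover the inner vertices not yet covered. The costs of the three dominating sets add up to at
  most \<open>4n - l + s - 2\<close>, so the smallest of them satisfies the bound.

  If the bound is attained, then all three sets are optimal and every estimate is tight. This
  forces every support vertex other than \<open>r\<close> to be the only child of an inner vertex, so below
  the fourth vertex from the end of a longest path from \<open>r\<close> only branches \<open>P\<^sub>3\<close> remain; removing them (or a strong
  leaf) undoes one of the operations and keeps the equality.

  Conversely, a tree of the family consists of matched pairs of vertices, of vertices of degree 2
  that connect two pairs, and of extra leaves. Each pair and each connector, taken with its edges,
  contributes at least two elements to a dominating set and each extra leaf at least one; counting the
  edges of the tree shows that this lower bound equals the upper bound.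
\<close>

subsection \<open>Rooted trees\<close>

text \<open>The constant comes from an exchange. Each phase leaves out the leaves and one level
  class of inner vertices, and pays for each of them with the edge to its parent; so it costs
  \<open>n\<close> plus a surplus. Over the three phases the surpluses add up to at most the number
  \<open>n - l - s\<close> of inner vertices, plus the number of support vertices with an inner
  parent, plus the number of inner vertices all of whose children are support vertices. Each of the
  last two numbers is at most \<open>s - 1\<close>, because the root is itself a support vertex and
  has no parent. This gives \<open>3n + (n - l - s) + 2(s - 1)\<close>. Hence the root has to be
  chosen at will, although a tree is given by connectivity and the absence of cycles only; parent
  and level functions with a change of root bridge the gap. The other obstacle is the path on two
  vertices, whose leaf is an arbitrary choice. The counting therefore uses symmetric notions of leaf
  and support vertex, and wherever a removal could end in this path, it is treated
  separately.\<close>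

locale rooted_tree =
  fixes G :: "'a pair_pre_digraph" and r :: 'a and par :: "'a \<Rightarrow> 'a" and lev :: "'a \<Rightarrow> nat"
  assumes finite_verts: "finite (pverts G)"
    and root_in_verts: "r \<in> pverts G"
    and par_in_verts: "v \<in> pverts G \<Longrightarrow> v \<noteq> r \<Longrightarrow> par v \<in> pverts G"
    and lev_par: "v \<in> pverts G \<Longrightarrow> v \<noteq> r \<Longrightarrow> lev v = Suc (lev (par v))"
    and arc_iff: "(u, v) \<in> parcs G \<longleftrightarrow>
      u \<in> pverts G \<and> v \<in> pverts G \<and> (u \<noteq> r \<and> par u = v \<or> v \<noteq> r \<and> par v = u)"

lemma rooted_tree_add_leaf:
  assumes "rooted_tree G r par lev" and "v \<in> pverts G" and "w \<notin> pverts G"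
    and H: "pverts H = insert w (pverts G)" "parcs H = parcs G \<union> {(v, w), (w, v)}"
  shows "rooted_tree H r (par(w := v)) (lev(w := Suc (lev v)))"
proof -
  interpret rooted_tree G r par lev by fact
  have vw: "v \<noteq> w" "r \<noteq> w" using assms root_in_verts by auto
  show ?thesis
  proof
    show "finite (pverts H)" using finite_verts H by simp
    show "r \<in> pverts H" using root_in_verts H by simp
  next
    fix u assume u: "u \<in> pverts H" "u \<noteq> r"
    show "(par(w := v)) u \<in> pverts H" using u par_in_verts assms H by auto
    show "(lev(w := Suc (lev v))) u = Suc ((lev(w := Suc (lev v))) ((par(w := v)) u))"
      using u lev_par[of u] par_in_verts[of u] assms H by (auto simp: vw)
  next
    fix a b
    show "(a, b) \<in> parcs H \<longleftrightarrow> a \<in> pverts H \<and> b \<in> pverts H \<and>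
      (a \<noteq> r \<and> (par(w := v)) a = b \<or> b \<noteq> r \<and> (par(w := v)) b = a)"
      using assms vw arc_iff[of a b] par_in_verts[of a] par_in_verts[of b] H by auto
  qed
qed

text \<open>The level of a root is not fixed, so the new root takes over the level of the old one
  and all other vertices move down by one.\<close>

lemma rooted_tree_add_root:
  assumes "rooted_tree G v par lev" and "w \<notin> pverts G"
    and H: "pverts H = insert w (pverts G)" "parcs H = parcs G \<union> {(v, w), (w, v)}"
  shows "rooted_tree H w (par(v := w)) (\<lambda>u. if u = w then lev v else Suc (lev u))"
proof -
  interpret rooted_tree G v par lev by fact
  have vw: "v \<noteq> w" using assms root_in_verts by auto
  show ?thesis
  proof
    show "finite (pverts H)" using finite_verts H by simp
    show "w \<in> pverts H" using H by simp
  next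
    fix u assume u: "u \<in> pverts H" "u \<noteq> w"
    show "(par(v := w)) u \<in> pverts H" using u par_in_verts assms H by auto
    have "u \<noteq> v \<Longrightarrow> par u \<noteq> w" using u par_in_verts[of u] assms H by auto
    then show "(if u = w then lev v else Suc (lev u)) =
        Suc (if (par(v := w)) u = w then lev v else Suc (lev ((par(v := w)) u)))"
      using u lev_par[of u] H by auto
  next
    fix a b
    show "(a, b) \<in> parcs H \<longleftrightarrow> a \<in> pverts H \<and> b \<in> pverts H \<and>
      (a \<noteq> w \<and> (par(v := w)) a = b \<or> b \<noteq> w \<and> (par(v := w)) b = a)"
      using assms vw arc_iff[of a b] par_in_verts[of a] par_in_verts[of b] root_in_verts H by auto
  qed
qed

definition induced :: "'a pair_pre_digraph \<Rightarrow> 'a set \<Rightarrow> 'a pair_pre_digraph" where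
  "induced G X = \<lparr> pverts = X, parcs = parcs G \<inter> X \<times> X \<rparr>"

lemma induced_simps [simp]:
  "pverts (induced G X) = X" "parcs (induced G X) = parcs G \<inter> X \<times> X"
  by (simp_all add: induced_def)

context rooted_tree
begin

lemma induced_rooted_tree:
  assumes "X \<subseteq> pverts G" "r \<in> X" "\<And>v. v \<in> X \<Longrightarrow> v \<noteq> r \<Longrightarrow> par v \<in> X"
  shows "rooted_tree (induced G X) r par lev"
proof
  show "finite (pverts (induced G X))" using assms finite_verts finite_subset by auto
  show "r \<in> pverts (induced G X)" using assms by simp
  show "par v \<in> pverts (induced G X)" if "v \<in> pverts (induced G X)" "v \<noteq> r" for v
    using that assms by simp
  show "lev v = Suc (lev (par v))" if "v \<in> pverts (induced G X)" "v \<noteq> r" for v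
    using that assms lev_par by auto
  show "(u, v) \<in> parcs (induced G X) \<longleftrightarrow> u \<in> pverts (induced G X) \<and> v \<in> pverts (induced G X) \<and>
      (u \<noteq> r \<and> par u = v \<or> v \<noteq> r \<and> par v = u)" for u v
    using assms arc_iff by auto
qed

lemma lev_induct [consumes 1, case_names root nonroot]:
  assumes "v \<in> pverts G"
    and "P r"
    and "\<And>v. v \<in> pverts G \<Longrightarrow> v \<noteq> r \<Longrightarrow> P (par v) \<Longrightarrow> P v"
  shows "P v"
  using assms(1)
proof (induction "lev v" arbitrary: v rule: less_induct)
  case less
  show ?case
  proof (cases "v = r")
    case False
    then have "P (par v)"
      using less lev_par par_in_verts by simp
    then show ?thesis using assms(3) less False by blast
  qed (use assms in simp)
qed

lemma obtain_deepest:
  assumes "pverts G \<noteq> {r}"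
  obtains y where "y \<in> pverts G" "y \<noteq> r" "\<And>u. u \<in> pverts G \<Longrightarrow> u \<noteq> r \<Longrightarrow> lev u \<le> lev y"
    "\<And>u. u \<in> pverts G \<Longrightarrow> u \<noteq> r \<Longrightarrow> par u \<noteq> y"
proof -
  let ?X = "pverts G - {r}"
  have ne: "?X \<noteq> {}" "finite ?X" using assms root_in_verts finite_verts by auto
  then have "Max (lev ` ?X) \<in> lev ` ?X" by (intro Max_in) auto
  then obtain y where y: "y \<in> ?X" "Max (lev ` ?X) = lev y" by auto
  have mx: "lev u \<le> lev y" if "u \<in> ?X" for u
    using that ne y(2) Max_ge[of "lev ` ?X" "lev u"] by simp
  show thesis
  proof
    show "par u \<noteq> y" if "u \<in> pverts G" "u \<noteq> r" for u
      using lev_par[OF that] mx[of u] that by auto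
  qed (use y mx in auto)
qed

lemma induced_remove_leaf:
  assumes "y \<in> pverts G" "y \<noteq> r" "\<And>u. u \<in> pverts G \<Longrightarrow> u \<noteq> r \<Longrightarrow> par u \<noteq> y"
  shows "rooted_tree (induced G (pverts G - {y})) r par lev"
    and "parcs G = parcs (induced G (pverts G - {y})) \<union> {(par y, y), (y, par y)}"
    and "par y \<in> pverts G - {y}"
proof -
  show py: "par y \<in> pverts G - {y}" using par_in_verts lev_par assms by fastforce
  show "rooted_tree (induced G (pverts G - {y})) r par lev"
    using assms par_in_verts root_in_verts by (intro induced_rooted_tree) auto
  show "parcs G = parcs (induced G (pverts G - {y})) \<union> {(par y, y), (y, par y)}"
  proof (intro equalityI subrelI)
    fix u v assume "(u, v) \<in> parcs G"
    then show "(u, v) \<in> parcs (induced G (pverts G - {y})) \<union> {(par y, y), (y, par y)}"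
      using arc_iff[of u v] assms(3)[of u] assms(3)[of v] by auto
  qed (use assms(1,2) py arc_iff in auto)
qed

lemma pair_wf: "pair_wf_digraph G"
  by unfold_locales (auto simp: arc_iff)

lemma reachable_in_tree:
  assumes "u \<in> pverts G" "v \<in> pverts G"
  shows "u \<rightarrow>\<^sup>*\<^bsub>with_proj G\<^esub> v"
proof -
  interpret pair_wf_digraph G by (rule pair_wf)
  have *: "u \<rightarrow>\<^sup>*\<^bsub>with_proj G\<^esub> r \<and> r \<rightarrow>\<^sup>*\<^bsub>with_proj G\<^esub> u" if "u \<in> pverts G" for u
    using that
  proof (induction u rule: lev_induct)
    case root
    then show ?case using root_in_verts by (simp add: reachable_refl)
  next
    case (nonroot v)
    have "v \<rightarrow>\<^sup>*\<^bsub>with_proj G\<^esub> par v" "par v \<rightarrow>\<^sup>*\<^bsub>with_proj G\<^esub> v"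
      using nonroot par_in_verts arc_iff by auto
    then show ?case using nonroot(3) reachable_trans by blast
  qed
  show ?thesis using *[OF assms(1)] *[OF assms(2)] reachable_trans by blast
qed

end

text \<open>A deepest vertex \<open>y\<close> is a leaf. The tree without \<open>y\<close> is
  rerooted, at \<open>par y\<close> if \<open>y\<close> itself is to become the root, and
  \<open>y\<close> is put back as a leaf or as the new root. No path between the two roots has to be
  reversed.\<close>

lemma rooted_tree_reroot:
  assumes "rooted_tree G r par lev" "r' \<in> pverts G"
  shows "\<exists>par lev. rooted_tree G r' par lev"
  using assms
proof (induction "card (pverts G)" arbitrary: G r' rule: less_induct)
  case less
  interpret rooted_tree G r par lev by fact
  show ?case
  proof (cases "pverts G = {r}")
    case True
    then have "rooted_tree G r' par lev" using less.prems by simp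
    then show ?thesis by (intro exI)
  next
    case False
    then obtain y where y: "y \<in> pverts G" "y \<noteq> r" "\<And>u. u \<in> pverts G \<Longrightarrow> u \<noteq> r \<Longrightarrow> par u \<noteq> y"
      using obtain_deepest by metis
    let ?G = "induced G (pverts G - {y})"
    note rem = induced_remove_leaf[OF y]
    have lt: "card (pverts ?G) < card (pverts G)"
      using card_Diff1_less[OF finite_verts y(1)] by simp
    have ins: "pverts G = insert y (pverts ?G)" using y by auto
    note IH = less.hyps[OF lt rem(1)]
    show ?thesis
    proof (cases "r' = y")
      case True
      have "par y \<in> pverts ?G" using rem(3) by simp
      then obtain p l where pl: "rooted_tree ?G (par y) p l" using IH by blast
      have "y \<notin> pverts ?G" by simp
      from rooted_tree_add_root[OF pl this ins rem(2)] show ?thesis unfolding True by (intro exI)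
    next
      case False
      then have "r' \<in> pverts ?G" using less.prems(2) by simp
      then obtain p l where pl: "rooted_tree ?G r' p l" using IH by blast
      have "par y \<in> pverts ?G" "y \<notin> pverts ?G" using rem(3) by simp_all
      from rooted_tree_add_leaf[OF pl this ins rem(2)] show ?thesis by (intro exI)
    qed
  qed
qed

section \<open>Rooted structure of connected graphs without cycles\<close>

lemma pawalk_verts_snoc: "pcas u q a \<Longrightarrow> pawalk_verts u (q @ [(a, b)]) = pawalk_verts u q @ [b]"
  by (induction q arbitrary: u) auto

text \<open>Subtrees grow by one vertex at a time: by connectivity an arc leaves \<open>X\<close>,
  and acyclicity makes its outer end adjacent to only one vertex of \<open>X\<close>, which becomes
  the parent. The root is left open since it can be changed afterwards.\<close>

lemma is_tree_rooted_subtree: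
  assumes "is_tree T" "Suc k \<le> card (pverts T)"
  shows "\<exists>X r par lev. X \<subseteq> pverts T \<and> card X = Suc k \<and> rooted_tree (induced T X) r par lev"
  using assms(2)
proof (induction k)
  interpret pair_graph T using assms(1) by (simp add: is_tree_def)
  case 0
  then obtain v where v: "v \<in> pverts T" by (cases "pverts T = {}") auto
  have "rooted_tree (induced T {v}) v id (\<lambda>_. 0)"
    by unfold_locales (use v in \<open>auto dest: no_loops'\<close>)
  then show ?case using v by (intro exI[of _ "{v}"]) auto
next
  interpret pair_graph T using assms(1) by (simp add: is_tree_def)
  case (Suc k)
  then obtain X r p l where X: "X \<subseteq> pverts T" "card X = Suc k" "rooted_tree (induced T X) r p l"
    by auto
  interpret X: rooted_tree "induced T X" r p l by fact
  have "X \<noteq> pverts T" using X Suc by auto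
  then obtain w0 where w0: "w0 \<in> pverts T" "w0 \<notin> X" using X by auto
  have rX: "r \<in> X" using X.root_in_verts by simp
  have "r \<rightarrow>\<^sup>*\<^bsub>with_proj T\<^esub> w0"
    using assms(1) w0 rX X(1) symmetric_connected_imp_strongly_connected[OF _ ]
    unfolding is_tree_def by (metis pair_sym_arcs strongly_connectedE subsetD with_proj_simps(1))
  then obtain v w where vw: "v \<in> X" "w \<notin> X" "(v, w) \<in> parcs T"
    using w0(2)
  proof (induction rule: reachable_induct)
    case base then show ?case using rX by auto
  next
    case (step x y) then show ?case by (metis with_proj_simps(2) dominatesI)
  qed
  have wT: "w \<in> pverts T" using vw in_arcsD2 by blast
  have uniq: "v' = v" if v': "v' \<in> X" "(v', w) \<in> parcs T" for v'
  proof (rule ccontr)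
    assume ne: "v' \<noteq> v"
    interpret XW: pair_wf_digraph "induced T X" by (rule X.pair_wf)
    have "v \<rightarrow>\<^sup>*\<^bsub>with_proj (induced T X)\<^esub> v'"
      using vw v' by (intro X.reachable_in_tree) auto
    then obtain q where q: "XW.apath v q v'" using XW.reachable_apath by auto
    have "subgraph (with_proj (induced T X)) (with_proj T)"
      using X(1) XW.wf_digraph wf_digraph by (intro subgraphI) (auto simp: compatible_def)
    then have q': "apath v q v'" using q subgraph_apath_imp_apath by blast
    have sub: "set (pawalk_verts v q) \<subseteq> X"
      using q XW.awalk_verts_in_verts[of v q] unfolding XW.apath_def XW.awalk_def by auto
    have qne: "q \<noteq> []" using q' ne apath_Nil_iff by metis
    \<comment> \<open>A path in \<open>X\<close> from \<open>v\<close> to \<open>v'\<close> closes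
      to a cycle through \<open>w\<close>. As \<open>v\<close> and \<open>v'\<close> differ,
      \<open>q\<close> is nonempty and the cycle has length at least 3, so it is not just an edge
      traversed back and forth.\<close>
    let ?p = "(w, v) # q @ [(v', w)]"
    have arcs: "(w, v) \<in> parcs T" "(v', w) \<in> parcs T"
      using vw v' arcs_symmetric by auto
    have aq: "awalk v q v'" and dq: "distinct (pawalk_verts v q)" using q' by (auto simp: apath_def)
    have "awalk v (q @ [(v', w)]) w"
      using arcs wT in_arcsD1 by (intro awalk_appendI[OF aq]) (auto simp: awalk_simps)
    then have vs: "pawalk_verts v (q @ [(v', w)]) = pawalk_verts v q @ [w]"
      using aq by (intro pawalk_verts_snoc) (auto simp: awalk_def)
    have "awalk w ?p w" using \<open>awalk v (q @ [(v', w)]) w\<close> arcs wT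
      by (simp add: awalk_Cons_iff del: awalk_append_iff)
    moreover have "distinct (tl (pawalk_verts w ?p))"
      using dq sub vw(2) by (auto simp: vs)
    ultimately have "cycle ?p" unfolding cycle_def by blast
    moreover have "3 \<le> length ?p" using qne by (cases q) auto
    ultimately show False using assms(1) unfolding is_tree_def by blast
  qed
  have "rooted_tree (induced T (insert w X)) r (p(w := v)) (l(w := Suc (l v)))"
  proof (rule rooted_tree_add_leaf[OF X(3)])
    show "parcs (induced T (insert w X)) = parcs (induced T X) \<union> {(v, w), (w, v)}"
    proof (intro equalityI subrelI)
      fix a b assume "(a, b) \<in> parcs (induced T (insert w X))"
      then have "(a, b) \<in> parcs T" "(b, a) \<in> parcs T" "a \<noteq> b" "a \<in> insert w X" "b \<in> insert w X"
        using arcs_symmetric[of a b] no_loops'[of a b] by auto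
      then show "(a, b) \<in> parcs (induced T X) \<union> {(v, w), (w, v)}"
        using uniq[of a] uniq[of b] by auto
    qed (use vw(1,3) arcs_symmetric[of v w] in auto)
  qed (use vw in auto)
  moreover have "finite X" using X by (metis card.infinite nat.distinct(1))
  ultimately show ?case using X vw wT by (intro exI[of _ "insert w X"]) auto
qed

lemma is_tree_rooted_tree:
  assumes "is_tree T" "r \<in> pverts T"
  shows "\<exists>par lev. rooted_tree T r par lev"
proof -
  interpret pair_graph T using assms(1) by (simp add: is_tree_def)
  have "card (pverts T) > 0" using assms(2) pair_finite_verts by (auto simp: card_gt_0_iff)
  then obtain X r' p l where X: "X \<subseteq> pverts T" "card X = card (pverts T)"
      "rooted_tree (induced T X) r' p l"
    using is_tree_rooted_subtree[OF assms(1), of "card (pverts T) - 1"] by auto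
  then have "X = pverts T" using pair_finite_verts card_subset_eq by blast
  moreover have "induced T (pverts T) = T"
    using in_arcsD1 in_arcsD2 by (auto intro!: pair_pre_digraph.equality)
  ultimately have "rooted_tree T r' p l" using X by simp
  then show ?thesis using assms(2) by (rule rooted_tree_reroot)
qed

subsection \<open>Total outer-independent domination of the subdivision graph\<close>

definition edges :: "'a pair_pre_digraph \<Rightarrow> 'a set set" where
  "edges G = {{u, v} | u v. (u, v) \<in> parcs G}"

text \<open>Unlike \<^const>\<open>leaves\<close> and \<^const>\<open>support\<close>, the next two sets contain both vertices of \<open>P\<^sub>2\<close>;
  the difference of their cardinalities is nevertheless the same.\<close>

definition pendants :: "'a pair_pre_digraph \<Rightarrow> 'a set" where
  "pendants G = {v \<in> pverts G. card (nbrs G v) = 1}"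

definition stems :: "'a pair_pre_digraph \<Rightarrow> 'a set" where
  "stems G = {v \<in> pverts G. nbrs G v \<inter> pendants G \<noteq> {}}"

text \<open>A set of vertices of the subdivision graph consists of old vertices \<open>A\<close> and of edges \<open>F\<close>.\<close>

definition dominating_pair :: "'a pair_pre_digraph \<Rightarrow> 'a set \<Rightarrow> 'a set set \<Rightarrow> bool" where
  "dominating_pair G A F \<longleftrightarrow> A \<subseteq> pverts G \<and> F \<subseteq> edges G \<and> (\<forall>v \<in> pverts G. \<exists>e \<in> F. v \<in> e) \<and>
     (\<forall>e \<in> edges G. \<exists>v \<in> A. v \<in> e) \<and> (\<forall>e \<in> edges G - F. e \<subseteq> A)"

context rooted_tree
begin

lemma arcs_sym: "(u, v) \<in> parcs G \<Longrightarrow> (v, u) \<in> parcs G"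
  using arc_iff by auto

lemma arcs_in_verts: "(u, v) \<in> parcs G \<Longrightarrow> u \<in> pverts G \<and> v \<in> pverts G"
  using arc_iff by auto

lemma par_neq: "v \<in> pverts G \<Longrightarrow> v \<noteq> r \<Longrightarrow> par v \<noteq> v"
  using lev_par by fastforce

lemma arcs_loopfree: "(u, v) \<in> parcs G \<Longrightarrow> u \<noteq> v"
  using arc_iff par_neq by auto

lemma edges_subset_verts: "e \<in> edges G \<Longrightarrow> e \<subseteq> pverts G"
  unfolding edges_def using arcs_in_verts by auto

lemma finite_edges: "finite (edges G)"
  using edges_subset_verts finite_verts by (intro finite_subset[of "edges G" "Pow (pverts G)"]) auto

lemma subdivision_arc_iff:
  "(x, y) \<in> parcs (subdivision_graph G) \<longleftrightarrow>
    (\<exists>u e. e \<in> edges G \<and> u \<in> e \<and> (x = Inl u \<and> y = Inr e \<or> x = Inr e \<and> y = Inl u))"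
  (is "?L \<longleftrightarrow> ?R")
proof
  assume ?R
  then obtain u a b where ab: "(a, b) \<in> parcs G" "u \<in> {a, b}"
      "x = Inl u \<and> y = Inr {a, b} \<or> x = Inr {a, b} \<and> y = Inl u"
    unfolding edges_def by auto
  then obtain v where "{a, b} = {u, v}" "(u, v) \<in> parcs G" using arcs_sym by blast
  then show ?L using ab(3) unfolding subdivision_graph_def by auto
qed (auto simp: subdivision_graph_def edges_def)

lemma subdivision_verts: "pverts (subdivision_graph G) = Inl ` pverts G \<union> Inr ` edges G"
  unfolding subdivision_graph_def edges_def by auto

text \<open>Adjacency in the subdivision graph is incidence. Hence an old vertex is dominated by an
  edge of \<open>F\<close> containing it and a new one by an end in \<open>A\<close>; outer
  independence says that an edge outside \<open>F\<close> has no end outside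
  \<open>A\<close>.\<close>

lemma TOIDS_iff_dominating_pair:
  "is_TOIDS (subdivision_graph G) (Inl ` A \<union> Inr ` F) \<longleftrightarrow> dominating_pair G A F" (is "?L \<longleftrightarrow> ?R")
proof
  assume L: ?L
  have sub: "A \<subseteq> pverts G" "F \<subseteq> edges G"
    using L unfolding is_TOIDS_def subdivision_verts by auto
  moreover have "\<exists>e \<in> F. v \<in> e" if "v \<in> pverts G" for v
  proof -
    have "Inl v \<in> pverts (subdivision_graph G)" using that by (simp add: subdivision_verts)
    then obtain u where "u \<in> Inl ` A \<union> Inr ` F" "(Inl v, u) \<in> parcs (subdivision_graph G)"
      using L unfolding is_TOIDS_def nbrs_def by blast
    then show ?thesis unfolding subdivision_arc_iff by auto
  qed
  moreover have "\<exists>v \<in> A. v \<in> e" if "e \<in> edges G" for e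
  proof -
    have "Inr e \<in> pverts (subdivision_graph G)" using that by (simp add: subdivision_verts)
    then obtain u where "u \<in> Inl ` A \<union> Inr ` F" "(Inr e, u) \<in> parcs (subdivision_graph G)"
      using L unfolding is_TOIDS_def nbrs_def by blast
    then show ?thesis unfolding subdivision_arc_iff by auto
  qed
  moreover have "e \<subseteq> A" if "e \<in> edges G - F" for e
  proof
    fix v assume v: "v \<in> e"
    show "v \<in> A"
    proof (rule ccontr)
      assume "v \<notin> A"
      then have "Inl v \<in> pverts (subdivision_graph G) - (Inl ` A \<union> Inr ` F)"
        "Inr e \<in> pverts (subdivision_graph G) - (Inl ` A \<union> Inr ` F)"
        using that v edges_subset_verts by (auto simp: subdivision_verts)
      then have "(Inl v, Inr e) \<notin> parcs (subdivision_graph G)" using L unfolding is_TOIDS_def by blast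
      then show False using that v unfolding subdivision_arc_iff by blast
    qed
  qed
  ultimately show ?R unfolding dominating_pair_def by blast
next
  assume R: ?R
  then have sub: "A \<subseteq> pverts G" "F \<subseteq> edges G"
    and cov: "\<And>v. v \<in> pverts G \<Longrightarrow> \<exists>e \<in> F. v \<in> e" "\<And>e. e \<in> edges G \<Longrightarrow> \<exists>v \<in> A. v \<in> e"
    and ind: "\<And>e. e \<in> edges G \<Longrightarrow> e \<notin> F \<Longrightarrow> e \<subseteq> A"
    unfolding dominating_pair_def by auto
  have "\<exists>u \<in> Inl ` A \<union> Inr ` F. (x, u) \<in> parcs (subdivision_graph G)"
    if "x \<in> pverts (subdivision_graph G)" for x
  proof (cases x)
    case (Inl v)
    then have "v \<in> pverts G" using that by (auto simp: subdivision_verts)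
    then obtain e where "e \<in> F" "v \<in> e" "e \<in> edges G" using cov(1) sub(2) by blast
    then show ?thesis using Inl by (intro bexI[of _ "Inr e"]) (auto simp: subdivision_arc_iff)
  next
    case (Inr e)
    then have "e \<in> edges G" using that by (auto simp: subdivision_verts)
    then obtain v where "v \<in> A" "v \<in> e" "e \<in> edges G" using cov(2) by blast
    then show ?thesis using Inr by (intro bexI[of _ "Inl v"]) (auto simp: subdivision_arc_iff)
  qed
  moreover have "(x, y) \<notin> parcs (subdivision_graph G)"
    if "x \<in> pverts (subdivision_graph G) - (Inl ` A \<union> Inr ` F)"
      "y \<in> pverts (subdivision_graph G) - (Inl ` A \<union> Inr ` F)" for x y
  proof
    assume "(x, y) \<in> parcs (subdivision_graph G)"
    then obtain u e where "e \<in> edges G" "u \<in> e" "x = Inl u \<and> y = Inr e \<or> x = Inr e \<and> y = Inl u"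
      unfolding subdivision_arc_iff by blast
    then show False using that ind[of e] by auto
  qed
  moreover have "Inl ` A \<union> Inr ` F \<subseteq> pverts (subdivision_graph G)"
    using sub unfolding subdivision_verts by auto
  ultimately show ?L unfolding is_TOIDS_def nbrs_def by (intro conjI ballI) simp_all
qed

lemma finite_dominating_pair:
  assumes "dominating_pair G A F"
  shows "finite A" "finite F"
  using assms finite_subset[OF _ finite_verts, of A] finite_subset[OF _ finite_edges, of F]
  unfolding dominating_pair_def by simp_all

lemma card_Inl_Un_Inr: "finite A \<Longrightarrow> finite F \<Longrightarrow> card (Inl ` A \<union> Inr ` F) = card A + card F"
  by (subst card_Un_disjoint) (auto simp: card_image)

lemma finite_TOIDS: "finite {D. is_TOIDS (subdivision_graph G) D}"
proof (rule finite_subset)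
  show "{D. is_TOIDS (subdivision_graph G) D} \<subseteq> Pow (pverts (subdivision_graph G))"
    by (auto simp: is_TOIDS_def)
qed (use finite_verts finite_edges in \<open>simp add: subdivision_verts\<close>)

lemma gamma_le:
  assumes "dominating_pair G A F"
  shows "gamma_t_oi (subdivision_graph G) \<le> card A + card F"
  unfolding gamma_t_oi_def
proof (rule Min_le)
  show "card A + card F \<in> card ` {D. is_TOIDS (subdivision_graph G) D}"
    using TOIDS_iff_dominating_pair assms card_Inl_Un_Inr[OF finite_dominating_pair[OF assms]]
    by (intro image_eqI[of _ _ "Inl ` A \<union> Inr ` F"]) auto
qed (use finite_TOIDS in simp)

lemma edge_par: "v \<in> pverts G \<Longrightarrow> v \<noteq> r \<Longrightarrow> {v, par v} \<in> edges G"
  unfolding edges_def using arc_iff[of v "par v"] par_in_verts by blast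

lemma edges_eq: "edges G = (\<lambda>v. {v, par v}) ` (pverts G - {r})"
proof (intro equalityI subsetI)
  fix e assume "e \<in> edges G"
  then obtain u v where "e = {u, v}" "(u, v) \<in> parcs G" unfolding edges_def by auto
  then show "e \<in> (\<lambda>v. {v, par v}) ` (pverts G - {r})" unfolding arc_iff by auto
qed (use edge_par in auto)

text \<open>An edge has only one lower end: two different ones would be parents of each other,
  against the levels.\<close>

lemma inj_on_edge_par: "inj_on (\<lambda>v. {v, par v}) (pverts G - {r})"
proof (rule inj_onI)
  fix u v assume uv: "u \<in> pverts G - {r}" "v \<in> pverts G - {r}" "{u, par u} = {v, par v}"
  show "u = v"
  proof (rule ccontr)
    assume "u \<noteq> v"
    then have "u = par v" "v = par u" using uv(3) by (auto simp: doubleton_eq_iff)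
    then show False using uv lev_par[of u] lev_par[of v] by auto
  qed
qed

lemma card_edges: "Suc (card (edges G)) = card (pverts G)"
  unfolding edges_eq card_image[OF inj_on_edge_par]
  using finite_verts root_in_verts by (metis card_Suc_Diff1)

lemma nbrs_nonempty:
  assumes "pverts G \<noteq> {r}" "v \<in> pverts G"
  shows "nbrs G v \<noteq> {}"
proof (cases "v = r")
  case True
  obtain w where "w \<in> pverts G" "w \<noteq> r" using assms root_in_verts by auto
  \<comment> \<open>On the way up from \<open>w\<close>, the last vertex before the root is a child
    of \<open>r\<close>.\<close>
  then have "\<exists>u \<in> pverts G. u \<noteq> r \<and> par u = r"
    by (induction w rule: lev_induct) (use par_in_verts in metis)+
  then show ?thesis using True root_in_verts unfolding nbrs_def by (auto simp: arc_iff)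
next
  case False
  then show ?thesis using assms par_in_verts unfolding nbrs_def by (auto simp: arc_iff)
qed

lemma dominating_pair_all:
  assumes "pverts G \<noteq> {r}"
  shows "dominating_pair G (pverts G) (edges G)"
proof -
  have "\<exists>e \<in> edges G. v \<in> e" if "v \<in> pverts G" for v
    using nbrs_nonempty[OF assms that] unfolding nbrs_def edges_def by blast
  moreover have "\<exists>v \<in> pverts G. v \<in> e" if "e \<in> edges G" for e
    using that arcs_in_verts unfolding edges_def by blast
  ultimately show ?thesis unfolding dominating_pair_def by simp
qed

lemma gamma_attained:
  assumes "pverts G \<noteq> {r}"
  obtains A F where "dominating_pair G A F"
    "gamma_t_oi (subdivision_graph G) = card A + card F"
proof -
  let ?D = "{D. is_TOIDS (subdivision_graph G) D}"
  have "?D \<noteq> {}" using dominating_pair_all[OF assms] TOIDS_iff_dominating_pair by blast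
  then have "gamma_t_oi (subdivision_graph G) \<in> card ` ?D"
    unfolding gamma_t_oi_def using finite_TOIDS by (intro Min_in) auto
  then obtain D where D: "is_TOIDS (subdivision_graph G) D" "gamma_t_oi (subdivision_graph G) = card D"
    by auto
  define A where "A = {v. Inl v \<in> D}"
  define F where "F = {e. Inr e \<in> D}"
  have eq: "D = Inl ` A \<union> Inr ` F"
  proof (intro equalityI subsetI)
    fix x assume "x \<in> D"
    then show "x \<in> Inl ` A \<union> Inr ` F" by (cases x) (auto simp: A_def F_def)
  qed (auto simp: A_def F_def)
  then have "dominating_pair G A F" using D(1) TOIDS_iff_dominating_pair by simp
  then show thesis using that D(2) eq card_Inl_Un_Inr finite_dominating_pair by metis
qed

subsection \<open>Leaves and support vertices of rooted trees\<close>

definition kids :: "'a \<Rightarrow> 'a set" where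
  "kids v = {u \<in> pverts G. u \<noteq> r \<and> par u = v}"

lemma kids_iff: "u \<in> kids v \<longleftrightarrow> u \<in> pverts G \<and> u \<noteq> r \<and> par u = v"
  unfolding kids_def by simp

lemma nbrs_root: "nbrs G r = kids r"
  unfolding nbrs_def kids_def using arc_iff root_in_verts par_in_verts by auto

lemma nbrs_nonroot: "v \<in> pverts G \<Longrightarrow> v \<noteq> r \<Longrightarrow> nbrs G v = insert (par v) (kids v)"
  unfolding nbrs_def kids_def using arc_iff par_in_verts by auto

lemma lev_kids: "u \<in> kids v \<Longrightarrow> lev u = Suc (lev v)"
  unfolding kids_def using lev_par by auto

lemma finite_kids: "finite (kids v)"
  unfolding kids_def using finite_verts by simp

lemma par_notin_kids: "v \<in> pverts G \<Longrightarrow> v \<noteq> r \<Longrightarrow> par v \<notin> kids v"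
  using lev_kids[of "par v" v] lev_par[of v] by (intro notI) simp

lemma card_nbrs_nonroot: "v \<in> pverts G \<Longrightarrow> v \<noteq> r \<Longrightarrow> card (nbrs G v) = Suc (card (kids v))"
  using nbrs_nonroot par_notin_kids finite_kids by simp

lemma pendant_nonroot_iff: "v \<in> pverts G \<Longrightarrow> v \<noteq> r \<Longrightarrow> v \<in> pendants G \<longleftrightarrow> kids v = {}"
  unfolding pendants_def using card_nbrs_nonroot finite_kids by simp

lemma nbrs_sym: "u \<in> nbrs G v \<longleftrightarrow> v \<in> nbrs G u"
  unfolding nbrs_def using arcs_sym[of u v] arcs_sym[of v u] by auto

lemma nbrs_in_verts: "nbrs G v \<subseteq> pverts G"
  unfolding nbrs_def using arcs_in_verts by auto

lemma finite_nbrs: "finite (nbrs G v)"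
  using finite_subset[OF nbrs_in_verts finite_verts] .

end

text \<open>Rooted at \<open>v\<close>, the tree has \<open>u\<close> as the only child of the root
  and nothing below \<open>u\<close>.\<close>

lemma adjacent_pendants:
  assumes "rooted_tree G r par lev" "v \<in> pendants G" "u \<in> pendants G" "u \<in> nbrs G v"
  shows "pverts G = {u, v}"
proof -
  have uv: "v \<in> pverts G" "u \<in> pverts G" using assms unfolding pendants_def by auto
  obtain p l where "rooted_tree G v p l" using rooted_tree_reroot[OF assms(1) uv(1)] by blast
  then interpret rooted_tree G v p l .
  have "u \<noteq> v" using assms(4) arcs_loopfree unfolding nbrs_def by blast
  have "card (kids v) = 1" "u \<in> kids v" using assms nbrs_root unfolding pendants_def by auto
  then have kv: "kids v = {u}" by (auto simp: card_1_singleton_iff)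
  have ku: "kids u = {}" using pendant_nonroot_iff[OF uv(2) \<open>u \<noteq> v\<close>] assms by blast
  have "w \<in> {u, v}" if "w \<in> pverts G" for w
    using that
  proof (induction w rule: lev_induct)
    case (nonroot w)
    then have "w \<in> kids (p w)" unfolding kids_def by simp
    then show ?case using nonroot(3) kv ku by auto
  qed simp
  then show ?thesis using uv by auto
qed

lemma card_verts_gt_2_imp_disjoint:
  assumes "rooted_tree G r par lev" "3 \<le> card (pverts G)"
  shows "pendants G \<inter> stems G = {}"
proof (rule ccontr)
  assume "pendants G \<inter> stems G \<noteq> {}"
  then obtain u v where "v \<in> pendants G" "u \<in> pendants G" "u \<in> nbrs G v" unfolding stems_def by auto
  from adjacent_pendants[OF assms(1) this] have "card (pverts G) \<le> 2" by (auto simp: card_insert_if)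
  then show False using assms(2) by simp
qed

subsection \<open>The upper bound\<close>

context rooted_tree
begin

text \<open>A vertex of \<open>K\<close> stands for the edge to its parent.\<close>

lemma gamma_le_parent_set:
  assumes A: "A \<subseteq> pverts G" and K: "K \<subseteq> pverts G - {r}"
    and cover: "\<And>v. v \<in> pverts G \<Longrightarrow> v \<in> K \<or> kids v \<inter> K \<noteq> {}"
    and vc: "\<And>v. v \<in> pverts G \<Longrightarrow> v \<noteq> r \<Longrightarrow> v \<in> A \<or> par v \<in> A"
    and ind: "\<And>v. v \<in> pverts G \<Longrightarrow> v \<noteq> r \<Longrightarrow> v \<notin> K \<Longrightarrow> v \<in> A \<and> par v \<in> A"
  shows "gamma_t_oi (subdivision_graph G) \<le> card A + card K"
proof -
  let ?F = "(\<lambda>v. {v, par v}) ` K"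
  have "\<exists>e \<in> ?F. v \<in> e" if "v \<in> pverts G" for v
    using cover[OF that] unfolding kids_def by auto
  moreover have "\<exists>v \<in> A. v \<in> e" if "e \<in> edges G" for e
    using that vc unfolding edges_eq by auto
  moreover have "e \<subseteq> A" if "e \<in> edges G - ?F" for e
    using that ind unfolding edges_eq by auto
  moreover have "?F \<subseteq> edges G" using K unfolding edges_eq by auto
  ultimately have "dominating_pair G A ?F"
    using A unfolding dominating_pair_def by blast
  then have "gamma_t_oi (subdivision_graph G) \<le> card A + card ?F" by (rule gamma_le)
  also have "card ?F \<le> card K"
    using finite_subset[OF K] finite_verts by (intro card_image_le) simp
  finally show ?thesis by simp
qed

end

lemma card_split_mod_3:
  fixes f :: "'a \<Rightarrow> nat"
  assumes "finite X"
  shows "card X = card {x \<in> X. f x mod 3 = 0} + card {x \<in> X. f x mod 3 = 1} + card {x \<in> X. f x mod 3 = 2}"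
proof -
  have "X = {x \<in> X. f x mod 3 = 0} \<union> {x \<in> X. f x mod 3 = 1} \<union> {x \<in> X. f x mod 3 = 2}" by auto
  then have "card X = card ({x \<in> X. f x mod 3 = 0} \<union> {x \<in> X. f x mod 3 = 1} \<union> {x \<in> X. f x mod 3 = 2})"
    by simp
  also have "\<dots> = card {x \<in> X. f x mod 3 = 0} + card {x \<in> X. f x mod 3 = 1} + card {x \<in> X. f x mod 3 = 2}"
    using assms by (subst card_Un_disjoint; auto)+
  finally show ?thesis .
qed

text \<open>The residue \<open>(j + 2) mod 3\<close> stands for the level class
  \<open>j - 1\<close>, written without truncated subtraction.\<close>

lemma mod_3_cases:
  fixes a j :: nat
  assumes "j < 3" "a mod 3 \<noteq> (j + 2) mod 3"
  shows "a mod 3 = j \<or> a mod 3 = Suc j mod 3"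
proof -
  consider "j = 0" | "j = 1" | "j = 2" using assms(1) by linarith
  then show ?thesis using assms(2) mod_less_divisor[of 3 a] by cases auto
qed

lemma Suc_mod_3:
  fixes a j :: nat
  shows "a mod 3 = Suc j mod 3 \<Longrightarrow> Suc a mod 3 = (j + 2) mod 3"
    and "j < 3 \<Longrightarrow> a mod 3 = (j + 2) mod 3 \<Longrightarrow> Suc a mod 3 = j"
    and "Suc a mod 3 \<noteq> a mod 3"
    and "j < 3 \<Longrightarrow> Suc j mod 3 \<noteq> j" and "j < 3 \<Longrightarrow> (j + 2) mod 3 \<noteq> j"
proof -
  show "Suc a mod 3 = (j + 2) mod 3" if "a mod 3 = Suc j mod 3"
    using arg_cong[OF that, of "\<lambda>i. Suc i mod 3"] by (simp add: mod_Suc_eq)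
  show "Suc a mod 3 = j" if "j < 3" "a mod 3 = (j + 2) mod 3"
    using arg_cong[OF that(2), of "\<lambda>i. Suc i mod 3"] that(1) by (simp add: mod_Suc_eq)
  show "Suc a mod 3 \<noteq> a mod 3" by (simp add: mod_Suc)
  show "Suc j mod 3 \<noteq> j" if "j < 3" using that by (auto simp: mod_Suc)
  show "(j + 2) mod 3 \<noteq> j" if "j < 3"
  proof -
    consider "j = 0" | "j = 1" | "j = 2" using \<open>j < 3\<close> by linarith
    then show ?thesis by cases auto
  qed
qed

text \<open>Pendants and stems are disjoint here, so the root is neither a pendant nor inner: every
  pendant and every inner vertex has an edge to its parent.\<close>

locale stem_rooted_tree = rooted_tree +
  assumes card_ge_3: "3 \<le> card (pverts G)" and root_stem: "r \<in> stems G"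
begin

definition inner :: "'a set" where
  "inner = pverts G - pendants G - stems G"

lemma disj: "pendants G \<inter> stems G = {}"
  using card_verts_gt_2_imp_disjoint[OF rooted_tree_axioms card_ge_3] .

lemma pendant_kids: "v \<in> pendants G \<Longrightarrow> v \<in> pverts G \<and> v \<noteq> r \<and> kids v = {} \<and> par v \<in> stems G"
proof -
  assume v: "v \<in> pendants G"
  then have *: "v \<in> pverts G" "v \<noteq> r" using root_stem disj unfolding pendants_def by auto
  then have "par v \<in> nbrs G v" "par v \<in> pverts G" using nbrs_nonroot par_in_verts by auto
  then have "par v \<in> stems G" using v nbrs_sym unfolding stems_def by blast
  then show ?thesis using v * pendant_nonroot_iff by blast
qed

text \<open>A pendant neighbour cannot be the parent, because pendants have no children under this
  root.\<close>

lemma stem_pendant_kid: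
  assumes "s \<in> stems G"
  shows "\<exists>u \<in> pendants G. u \<in> kids s"
proof -
  obtain u where u: "s \<in> pverts G" "u \<in> pendants G" "u \<in> nbrs G s" using assms unfolding stems_def by auto
  show ?thesis
  proof (cases "s = r")
    case True then show ?thesis using u nbrs_root by auto
  next
    case False
    then have "s \<in> kids (par s)" using u unfolding kids_def by simp
    then have "u \<noteq> par s" using pendant_kids[OF u(2)] by auto
    then show ?thesis using u nbrs_nonroot False by auto
  qed
qed

lemma inner_kids:
  assumes "v \<in> inner"
  shows "v \<in> pverts G" "v \<noteq> r" "kids v \<noteq> {}" "kids v \<inter> pendants G = {}" "par v \<notin> pendants G"
    "v \<notin> pendants G" "v \<notin> stems G"
proof -
  show v: "v \<in> pverts G" "v \<noteq> r" "v \<notin> pendants G" "v \<notin> stems G"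
    using assms root_stem unfolding inner_def by auto
  show "kids v \<noteq> {}" using v pendant_nonroot_iff by blast
  show "kids v \<inter> pendants G = {}" "par v \<notin> pendants G" using v nbrs_nonroot unfolding stems_def by auto
qed

lemma verts_cases:
  assumes "v \<in> pverts G"
  obtains "v \<in> pendants G" | "v \<in> stems G" | "v \<in> inner"
  using assms unfolding inner_def by auto

lemma stems_in_verts: "stems G \<subseteq> pverts G" and pendants_in_verts: "pendants G \<subseteq> pverts G"
  unfolding stems_def pendants_def by auto

definition heir :: "'a \<Rightarrow> 'a" where "heir w = (SOME u. u \<in> kids w)"

text \<open>Only for these stems may the parent be missing from \<open>phase_verts\<close>; the edge
  above them is then compulsory.\<close>

definition low_stems :: "'a set" where
  "low_stems = {s \<in> stems G - {r}. par s \<in> inner}"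

definition pre_stems :: "'a set" where
  "pre_stems = {w \<in> inner. kids w \<subseteq> stems G}"

text \<open>The inner vertices on level \<open>j\<close> are left out of \<open>phase_verts j\<close>. Then all edges at these vertices
  are needed (in \<open>phase_edges\<close>, an edge is again represented by its lower end), and they cover the levels
  \<open>j - 1\<close>, \<open>j\<close> and \<open>j + 1\<close> except for children of support vertices and for parents all of
  whose children are support vertices. The latter are covered by the edge to their heir.\<close>

definition phase_verts :: "nat \<Rightarrow> 'a set" where
  "phase_verts j = pverts G - pendants G - {v \<in> inner. lev v mod 3 = j}"

definition phase_edges :: "nat \<Rightarrow> 'a set" where
  "phase_edges j = pendants G \<union> {v \<in> inner. lev v mod 3 = j} \<union> {v \<in> inner. lev v mod 3 = Suc j mod 3}
     \<union> {s \<in> low_stems. lev s mod 3 = Suc j mod 3} \<union> heir ` {w \<in> pre_stems. lev w mod 3 = (j + 2) mod 3}"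

lemma heir_kid:
  assumes "w \<in> inner"
  shows "heir w \<in> kids w"
proof -
  have "\<exists>u. u \<in> kids w" using inner_kids(3)[OF assms] by blast
  then show ?thesis unfolding heir_def by (rule someI_ex)
qed

lemma heir_low_stem:
  assumes "w \<in> pre_stems"
  shows "heir w \<in> low_stems"
proof -
  have w: "w \<in> inner" "kids w \<subseteq> stems G" using assms by (simp_all add: pre_stems_def)
  note h = heir_kid[OF w(1)]
  have "heir w \<in> stems G" "heir w \<noteq> r" "par (heir w) = w" using h w(2) kids_iff by blast+
  then show ?thesis unfolding low_stems_def using w(1) by simp
qed

lemma inj_on_heir: "inj_on heir pre_stems"
proof (rule inj_on_inverseI)
  show "par (heir w) = w" if "w \<in> pre_stems" for w
    using heir_kid[of w] that kids_iff unfolding pre_stems_def by blast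
qed

lemma finites: "finite inner" "finite (pendants G)" "finite (stems G)" "finite low_stems" "finite pre_stems"
  using finite_verts unfolding inner_def pendants_def stems_def low_stems_def pre_stems_def by auto

lemma phase_edges_subset: "phase_edges j \<subseteq> pverts G - {r}"
proof -
  have "heir ` {w \<in> pre_stems. lev w mod 3 = (j + 2) mod 3} \<subseteq> low_stems" using heir_low_stem by auto
  moreover have "low_stems \<subseteq> pverts G - {r}" unfolding low_stems_def using stems_in_verts by auto
  moreover have "pendants G \<subseteq> pverts G - {r}" using pendant_kids by auto
  moreover have "inner \<subseteq> pverts G - {r}" using inner_kids by auto
  ultimately show ?thesis unfolding phase_edges_def by auto
qed

lemma phase_verts_iff: "v \<in> phase_verts j \<longleftrightarrow> v \<in> stems G \<or> v \<in> inner \<and> lev v mod 3 \<noteq> j"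
  unfolding phase_verts_def inner_def using disj stems_in_verts by auto

lemma phase_cover:
  assumes "j < 3" "v \<in> pverts G"
  shows "v \<in> phase_edges j \<or> kids v \<inter> phase_edges j \<noteq> {}"
  using assms(2)
proof (cases rule: verts_cases)
  case 1 then show ?thesis unfolding phase_edges_def by auto
next
  case 2
  then show ?thesis using stem_pendant_kid unfolding phase_edges_def by auto
next
  case 3
  show ?thesis
  proof (cases "lev v mod 3 = (j + 2) mod 3")
    case True
    show ?thesis
    proof (cases "kids v \<subseteq> stems G")
      case sub: True
      then have "heir v \<in> phase_edges j" using 3 True unfolding phase_edges_def pre_stems_def by auto
      then show ?thesis using heir_kid[OF 3] by auto
    next
      case False
      then obtain u where u: "u \<in> kids v" "u \<in> inner"
        using inner_kids(4)[OF 3] unfolding inner_def kids_def by auto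
      have "lev u mod 3 = j" using Suc_mod_3(2)[OF assms(1) True] lev_kids[OF u(1)] by simp
      then show ?thesis using u unfolding phase_edges_def by auto
    qed
  next
    case False
    then have "lev v mod 3 = j \<or> lev v mod 3 = Suc j mod 3" by (rule mod_3_cases[OF assms(1)])
    then show ?thesis using 3 unfolding phase_edges_def by auto
  qed
qed

text \<open>Adjacent inner vertices lie in different level classes, so they are never both left out;
  the parent of a pendant is a stem, and stems are always kept.\<close>

lemma phase_vertex_cover:
  assumes "v \<in> pverts G" "v \<noteq> r"
  shows "v \<in> phase_verts j \<or> par v \<in> phase_verts j"
  using assms(1)
proof (cases rule: verts_cases)
  case 3
  have "par v \<in> stems G \<or> par v \<in> inner"
    using inner_kids[OF 3] par_in_verts assms unfolding inner_def by blast
  moreover have "lev v mod 3 \<noteq> lev (par v) mod 3" unfolding lev_par[OF assms] by (rule Suc_mod_3(3))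
  ultimately show ?thesis using 3 unfolding phase_verts_iff by auto
qed (use pendant_kids phase_verts_iff in auto)

text \<open>By contraposition: a lower end that is left out is a pendant or an inner vertex of class
  \<open>j\<close>, hence itself in \<open>phase_edges\<close>. A child of an inner vertex of class
  \<open>j\<close> has class \<open>j + 1\<close> and is inner or in
  \<open>low_stems\<close>.\<close>

lemma phase_independent:
  assumes "v \<in> pverts G" "v \<noteq> r" "v \<notin> phase_edges j"
  shows "v \<in> phase_verts j \<and> par v \<in> phase_verts j"
proof -
  have v: "v \<notin> pendants G" using assms(3) unfolding phase_edges_def by auto
  have k: "v \<in> kids (par v)" using assms unfolding kids_def by simp
  then have p: "par v \<notin> pendants G" using pendant_kids by blast
  have "v \<in> phase_verts j"
    using assms v unfolding phase_verts_iff phase_edges_def inner_def by auto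
  moreover have "lev v mod 3 = Suc j mod 3" if "lev (par v) mod 3 = j"
    unfolding that[symmetric] lev_par[OF assms(1,2)] by (simp add: mod_Suc_eq)
  then have "\<not> (par v \<in> inner \<and> lev (par v) mod 3 = j)"
    using assms v unfolding phase_edges_def low_stems_def inner_def by auto
  then have "par v \<in> phase_verts j"
    using p par_in_verts[OF assms(1,2)] unfolding phase_verts_iff inner_def by auto
  ultimately show ?thesis by simp
qed

lemma gamma_le_phase:
  assumes "j < 3"
  shows "gamma_t_oi (subdivision_graph G) \<le> card (phase_verts j) + card (phase_edges j)"
proof (rule gamma_le_parent_set)
  show "phase_verts j \<subseteq> pverts G" by (auto simp: phase_verts_def)
qed (fact phase_edges_subset phase_cover[OF assms] phase_vertex_cover
    phase_independent[THEN conjunct1] phase_independent)+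

text \<open>The pendants and the inner vertices of class \<open>j\<close> are missing from
  \<open>phase_verts\<close> but occur in \<open>phase_edges\<close>; they cancel out, and only the
  remaining three parts of \<open>phase_edges\<close> exceed \<open>card (pverts G)\<close>.\<close>

lemma card_phase_le:
  "card (phase_verts j) + card (phase_edges j) \<le> card (pverts G) + card {v \<in> inner. lev v mod 3 = Suc j mod 3}
     + card {s \<in> low_stems. lev s mod 3 = Suc j mod 3} + card {w \<in> pre_stems. lev w mod 3 = (j + 2) mod 3}"
proof -
  let ?I = "{v \<in> inner. lev v mod 3 = j}"
  let ?C = "heir ` {w \<in> pre_stems. lev w mod 3 = (j + 2) mod 3}"
  have "card (phase_verts j) = card (pverts G) - card (pendants G \<union> ?I)"
  proof -
    have "phase_verts j = pverts G - (pendants G \<union> ?I)" unfolding phase_verts_def by auto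
    moreover have "pendants G \<union> ?I \<subseteq> pverts G" using pendants_in_verts inner_kids(1) by auto
    ultimately show ?thesis using finites by (simp add: card_Diff_subset)
  qed
  moreover have "card (pendants G \<union> ?I) = card (pendants G) + card ?I"
    using finites inner_kids(6) by (intro card_Un_disjoint) auto
  moreover have "card (pendants G \<union> ?I) \<le> card (pverts G)"
    using finite_verts pendants_in_verts inner_kids(1) by (intro card_mono) auto
  moreover have "card ?C \<le> card {w \<in> pre_stems. lev w mod 3 = (j + 2) mod 3}"
    using finites by (intro card_image_le) auto
  moreover have "card (phase_edges j) \<le> card (pendants G) + card ?I + card {v \<in> inner. lev v mod 3 = Suc j mod 3}
     + card {s \<in> low_stems. lev s mod 3 = Suc j mod 3} + card ?C"
    unfolding phase_edges_def
    by (intro order_trans[OF card_Un_le] add_mono order_refl)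
  ultimately show ?thesis by linarith
qed

lemma card_low_stems_le: "Suc (card low_stems) \<le> card (stems G)"
proof -
  have "card low_stems \<le> card (stems G - {r})" using finites by (intro card_mono) (auto simp: low_stems_def)
  then show ?thesis using card_Suc_Diff1[OF finites(3) root_stem] by simp
qed

lemma card_pre_stems_le: "card pre_stems \<le> card low_stems"
  using heir_low_stem by (intro card_inj_on_le[OF inj_on_heir _ finites(4)]) blast

lemma card_inner: "card inner + card (pendants G) + card (stems G) = card (pverts G)"
proof -
  have "card (pverts G) = card (inner \<union> (pendants G \<union> stems G))"
    using stems_in_verts pendants_in_verts unfolding inner_def by (intro arg_cong[where f = card]) blast
  also have "\<dots> = card inner + card (pendants G \<union> stems G)"
    using finites unfolding inner_def by (intro card_Un_disjoint) blast+
  also have "card (pendants G \<union> stems G) = card (pendants G) + card (stems G)"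
    using finites disj by (intro card_Un_disjoint)
  finally show ?thesis by simp
qed

definition phase_cost :: "nat \<Rightarrow> nat" where
  "phase_cost j = card (phase_verts j) + card (phase_edges j)"

text \<open>As \<open>j\<close> runs through the three classes, so do \<open>Suc j mod 3\<close> and
  \<open>(j + 2) mod 3\<close>; each surplus term therefore adds up to the size of its whole
  set.\<close>

lemma sum_phase_cost_le:
  "phase_cost 0 + phase_cost 1 + phase_cost 2
     \<le> 3 * card (pverts G) + card inner + card low_stems + card pre_stems"
proof -
  have m: "Suc 0 mod 3 = 1" "Suc 1 mod 3 = 2" "Suc 2 mod 3 = 0" "(0 + 2) mod 3 = (2 :: nat)"
    "(1 + 2) mod 3 = (0 :: nat)" "(2 + 2) mod 3 = (1 :: nat)" by simp_all
  show ?thesis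
    using card_phase_le[of 0] card_phase_le[of 1] card_phase_le[of 2]
      card_split_mod_3[OF finites(1), of lev] card_split_mod_3[OF finites(4), of lev]
      card_split_mod_3[OF finites(5), of lev]
    unfolding m phase_cost_def by linarith
qed

lemma gamma_le_phase_cost: "j < 3 \<Longrightarrow> gamma_t_oi (subdivision_graph G) \<le> phase_cost j"
  unfolding phase_cost_def by (rule gamma_le_phase)

lemma gamma_le_phase_costs:
  "gamma_t_oi (subdivision_graph G) \<le> phase_cost 0"
  "gamma_t_oi (subdivision_graph G) \<le> phase_cost 1"
  "gamma_t_oi (subdivision_graph G) \<le> phase_cost 2"
  by (rule gamma_le_phase_cost, simp)+

lemma gamma_upper_bound:
  "3 * gamma_t_oi (subdivision_graph G) + card (pendants G) + 2 \<le> 4 * card (pverts G) + card (stems G)"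
  using gamma_le_phase_costs sum_phase_cost_le card_low_stems_le card_pre_stems_le card_inner
  by linarith

end

section \<open>Trees that attain the upper bound\<close>

context stem_rooted_tree
begin

context
  assumes tight: "3 * gamma_t_oi (subdivision_graph G) + card (pendants G) + 2
    = 4 * card (pverts G) + card (stems G)"
begin

text \<open>The bound is a sum of inequalities, three for the phase costs and one each for
  \<open>low_stems\<close> and \<open>pre_stems\<close>; equality at the end leaves no slack in any
  of them.\<close>

lemma tight_counts:
  "Suc (card low_stems) = card (stems G)" "card pre_stems = card low_stems"
  "phase_cost 0 = gamma_t_oi (subdivision_graph G)" "phase_cost 1 = gamma_t_oi (subdivision_graph G)"
  "phase_cost 2 = gamma_t_oi (subdivision_graph G)"
  using tight gamma_le_phase_costs sum_phase_cost_le card_low_stems_le card_pre_stems_le card_inner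
  by linarith+

lemma tight_phase_cost:
  assumes "j < 3"
  shows "phase_cost j = gamma_t_oi (subdivision_graph G)"
proof -
  consider "j = 0" | "j = 1" | "j = 2" using assms by linarith
  then show ?thesis using tight_counts by cases simp_all
qed

lemma tight_low_stems: "low_stems = stems G - {r}"
proof (rule card_subset_eq)
  show "low_stems \<subseteq> stems G - {r}" by (auto simp: low_stems_def)
  show "card low_stems = card (stems G - {r})"
    using tight_counts(1) card_Suc_Diff1[OF finites(3) root_stem] by linarith
qed (use finites in simp)

lemma tight_heir_image: "heir ` pre_stems = low_stems"
proof (rule card_subset_eq)
  show "card (heir ` pre_stems) = card low_stems"
    using tight_counts(2) card_image[OF inj_on_heir] by simp
qed (use finites heir_low_stem in \<open>blast+\<close>)

text \<open>Every stem other than the root is the heir of its parent, and this parent has only stems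
  as children. A sibling would be an heir of the same parent as well, hence the same vertex.\<close>

lemma tight_stem:
  assumes "s \<in> stems G" "s \<noteq> r"
  shows "par s \<in> inner" "kids (par s) = {s}"
proof -
  have low: "s \<in> low_stems" using assms tight_low_stems by blast
  then show "par s \<in> inner" by (simp add: low_stems_def)
  have heir_par: "t = heir (par t) \<and> par t \<in> pre_stems" if "t \<in> low_stems" for t
  proof -
    obtain w where w: "w \<in> pre_stems" "t = heir w" using tight_heir_image \<open>t \<in> low_stems\<close> by blast
    then have "par t = w" using heir_kid[of w] kids_iff unfolding pre_stems_def by blast
    then show ?thesis using w by simp
  qed
  have "t = s" if t: "t \<in> kids (par s)" for t
  proof -
    have "t \<in> stems G" using t heir_par[OF low] unfolding pre_stems_def by blast
    moreover have "t \<noteq> r" "par t = par s" using t kids_iff by blast+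
    ultimately have "t \<in> low_stems" using tight_low_stems by blast
    then show ?thesis using heir_par[of t] heir_par[OF low] \<open>par t = par s\<close> by metis
  qed
  moreover have "s \<in> kids (par s)" using assms stems_in_verts kids_iff by blast
  ultimately show "kids (par s) = {s}" by blast
qed

text \<open>Otherwise, in the phase that covers \<open>x\<close> and \<open>a\<close> by the two edges \<open>{x, par x}\<close> and \<open>{b, a}\<close>, the
  single edge \<open>{a, x}\<close> could replace both.\<close>

lemma tight_no_short_branch:
  assumes "x \<in> inner" "par x \<in> stems G" "a \<in> kids x" "a \<in> inner" "b \<in> kids a"
  shows "b \<notin> stems G"
proof
  assume b: "b \<in> stems G"
  \<comment> \<open>This puts \<open>x\<close> into the class \<open>j + 1\<close>, \<open>a\<close>
    into \<open>j - 1\<close> and \<open>b\<close> into \<open>j\<close>. The phase then contains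
    the edge above \<open>x\<close> because \<open>x\<close> is inner, and the edge above
    \<open>b\<close> because \<open>b\<close> is the heir of \<open>a\<close>.\<close>
  define j where "j = (lev x + 2) mod 3"
  have j: "j < 3" "lev x mod 3 = Suc j mod 3" unfolding j_def by (simp_all add: mod_Suc_eq)
  have b': "b \<in> pverts G" "b \<noteq> r" "par b = a" using assms(5) kids_iff by blast+
  have a': "a \<in> pverts G" "a \<noteq> r" "par a = x" using assms(3) kids_iff by blast+
  have x': "x \<in> pverts G" "x \<noteq> r" using inner_kids[OF assms(1)] by blast+
  have ka: "kids a = {b}" using tight_stem[OF b b'(2)] b' by simp
  have lev_a: "lev a mod 3 = (j + 2) mod 3" using Suc_mod_3(1)[OF j(2)] lev_kids[OF assms(3)] by simp
  have neq: "x \<noteq> b" "a \<noteq> b" "x \<noteq> a"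
    using b inner_kids(7)[OF assms(1)] inner_kids(7)[OF assms(4)] par_neq[OF a'(1,2)] a'(3) by blast+
  let ?K = "insert a (phase_edges j - {x, b})"
  have x_in: "x \<in> phase_edges j" using assms(1) j unfolding phase_edges_def by blast
  have "a \<in> pre_stems" using assms(4) ka b unfolding pre_stems_def by simp
  moreover have "heir a = b" using heir_kid[OF assms(4)] ka by simp
  ultimately have b_in: "b \<in> phase_edges j" using lev_a unfolding phase_edges_def by blast
  have fin: "finite (phase_edges j)" using finite_subset[OF phase_edges_subset] finite_verts by simp
  have "card (phase_edges j - {x, b}) = card (phase_edges j) - 2"
    using x_in b_in neq fin by (simp add: card_Diff_subset)
  moreover have "card {x, b} \<le> card (phase_edges j)"
    using x_in b_in fin by (intro card_mono) auto
  moreover have "card {x, b} = 2" using neq by simp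
  moreover have "card ?K \<le> Suc (card (phase_edges j - {x, b}))"
    using fin by (simp add: card_insert_if)
  ultimately have "card ?K < card (phase_edges j)" by linarith
  moreover have "gamma_t_oi (subdivision_graph G) \<le> card (phase_verts j) + card ?K"
  proof (rule gamma_le_parent_set)
    show "phase_verts j \<subseteq> pverts G" by (auto simp: phase_verts_def)
    show "?K \<subseteq> pverts G - {r}" using phase_edges_subset a' by blast
    show "v \<in> ?K \<or> kids v \<inter> ?K \<noteq> {}" if v: "v \<in> pverts G" for v
    proof -
      \<comment> \<open>Dropping the two edges can uncover only \<open>x\<close>, \<open>a\<close>,
        \<open>b\<close> and \<open>par x\<close>. The last two are stems and keep the edge to a
        pendant child; the new edge covers the first two.\<close>
      consider "v \<in> stems G" | "v = x" | "v = a" | "v \<notin> stems G" "v \<noteq> x" "v \<noteq> a" by blast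
      then show ?thesis
      proof cases
        case 1
        then obtain u where u: "u \<in> pendants G" "u \<in> kids v" using stem_pendant_kid by blast
        then have "u \<noteq> x" "u \<noteq> b" using inner_kids(6)[OF assms(1)] b disj by blast+
        then show ?thesis using u unfolding phase_edges_def by blast
      next
        case 2 then show ?thesis using assms(3) by blast
      next
        case 4
        then have "v \<noteq> b" using b by blast
        have "b \<notin> kids v" "x \<notin> kids v" using 4 assms(2) b'(3) unfolding kids_iff by auto
        then have "v \<in> phase_edges j - {x, b} \<or> kids v \<inter> (phase_edges j - {x, b}) \<noteq> {}"
          using phase_cover[OF j(1) v] 4(2) \<open>v \<noteq> b\<close> by auto
        then show ?thesis by auto
      qed simp
    qed
    show "v \<in> phase_verts j \<or> par v \<in> phase_verts j" if "v \<in> pverts G" "v \<noteq> r" for v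
      using phase_vertex_cover that .
    show "v \<in> phase_verts j \<and> par v \<in> phase_verts j" if v: "v \<in> pverts G" "v \<noteq> r" "v \<notin> ?K" for v
    proof -
      \<comment> \<open>An edge may be dropped if both its ends are kept: neither \<open>x\<close>
        nor \<open>a\<close> is in the class \<open>j\<close>, and \<open>par x\<close> and
        \<open>b\<close> are stems.\<close>
      consider "v = x" | "v = b" | "v \<notin> phase_edges j" using v(3) by blast
      then show ?thesis
      proof cases
        case 1
        have "lev x mod 3 \<noteq> j" using Suc_mod_3(4)[OF j(1)] j(2) by simp
        then show ?thesis unfolding 1 phase_verts_iff using assms(1,2) by simp
      next
        case 2
        have "lev a mod 3 \<noteq> j" using Suc_mod_3(5)[OF j(1)] lev_a by simp
        then show ?thesis unfolding 2 phase_verts_iff b'(3) using b assms(4) by simp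
      next
        case 3
        then show ?thesis using phase_independent v by blast
      qed
    qed
  qed
  ultimately show False using tight_phase_cost[OF j(1)] unfolding phase_cost_def by linarith
qed

end

end

subsection \<open>The structure of the family and the lower bound\<close>

text \<open>\<open>M\<close> is the set of matched vertices with matching \<open>m\<close>, \<open>A\<close> the set of connectors, and \<open>X\<close> the set of
  extra leaves produced by the first operation.\<close>

locale mated_graph =
  fixes G :: "'a pair_pre_digraph" and m :: "'a \<Rightarrow> 'a" and M A X :: "'a set"
  assumes finite_verts: "finite (pverts G)"
    and arcs_subset: "parcs G \<subseteq> pverts G \<times> pverts G"
    and arcs_sym: "(u, v) \<in> parcs G \<Longrightarrow> (v, u) \<in> parcs G"
    and verts_eq: "pverts G = M \<union> A \<union> X"
    and disjoint: "M \<inter> A = {}" "M \<inter> X = {}" "A \<inter> X = {}"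
    and mate: "v \<in> M \<Longrightarrow> m v \<in> M \<and> m v \<noteq> v \<and> m (m v) = v \<and> nbrs G v \<inter> M = {m v}"
    and connector: "a \<in> A \<Longrightarrow> card (nbrs G a) = 2 \<and> nbrs G a \<subseteq> M"
    and extra: "x \<in> X \<Longrightarrow> \<exists>v \<in> M. nbrs G x = {v} \<and> nbrs G (m v) = {v}"
begin

lemma nbrs_sym: "u \<in> nbrs G v \<longleftrightarrow> v \<in> nbrs G u"
  unfolding nbrs_def using arcs_sym[of u v] arcs_sym[of v u] by auto

lemma finite_nbrs: "finite (nbrs G v)"
  using finite_subset[of "nbrs G v" "pverts G"] finite_verts arcs_subset unfolding nbrs_def by auto

lemma nbrs_subset: "nbrs G v \<subseteq> pverts G - {v}"
proof
  fix u assume u: "u \<in> nbrs G v"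
  then have uv: "u \<in> pverts G" "v \<in> pverts G" using arcs_subset unfolding nbrs_def by auto
  moreover have "v \<notin> nbrs G v"
  proof -
    consider "v \<in> M" | "v \<in> A" | "v \<in> X" using uv verts_eq by blast
    then show ?thesis
    proof cases
      case 1 then show ?thesis using mate[OF 1] 1 by (metis IntI singletonD)
    next
      case 2 then show ?thesis using connector[of v] disjoint by auto
    next
      case 3 then show ?thesis using extra[of v] disjoint by auto
    qed
  qed
  ultimately show "u \<in> pverts G - {v}" using u by auto
qed

lemma nbrs_nonempty:
  assumes "v \<in> pverts G"
  shows "nbrs G v \<noteq> {}"
proof -
  consider "v \<in> M" | "v \<in> A" | "v \<in> X" using assms verts_eq by blast
  then show ?thesis
  proof cases
    case 1 then show ?thesis using mate[of v] by auto
  next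
    case 2 then show ?thesis using connector[of v] by auto
  next
    case 3 then show ?thesis using extra[of v] by auto
  qed
qed

lemma pendants_iff: "v \<in> pendants G \<longleftrightarrow> (\<exists>u. nbrs G v = {u})"
proof
  assume "\<exists>u. nbrs G v = {u}"
  then obtain u where u: "nbrs G v = {u}" by blast
  then have "(v, u) \<in> parcs G" unfolding nbrs_def by auto
  then show "v \<in> pendants G" using u arcs_subset unfolding pendants_def by auto
qed (auto simp: pendants_def card_1_singleton_iff)

text \<open>A pendant neighbour of \<open>s\<close> is not a connector. If it is matched, it is the
  mate of \<open>s\<close>; if it is extra, the condition on \<open>X\<close> makes the mate of
  \<open>s\<close> a leaf, too.\<close>

lemma stem_mate:
  assumes "s \<in> stems G"
  shows "s \<in> M \<and> nbrs G (m s) = {s}"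
proof -
  obtain u where u: "u \<in> pendants G" "u \<in> nbrs G s" using assms unfolding stems_def by auto
  then have nu: "nbrs G u = {s}" using nbrs_sym[of s u] pendants_iff[of u] by auto
  have "u \<in> pverts G" using u(1) unfolding pendants_def by simp
  then consider "u \<in> M" | "u \<in> A" | "u \<in> X" using verts_eq by blast
  then show ?thesis
  proof cases
    case 1
    then have "m u = s" using mate[of u] nu by blast
    then show ?thesis using mate[of u] 1 nu by auto
  next
    case 2 then show ?thesis using connector[of u] nu by simp
  next
    case 3 then show ?thesis using extra[of u] nu by auto
  qed
qed

text \<open>The mates of the stems are distinct pendants, and they are not extra leaves since they
  lie in \<open>M\<close>.\<close>

lemma card_extra_stems_le: "card X + card (stems G) \<le> card (pendants G)"
proof -
  have fin: "finite (stems G)" "finite (pendants G)" "finite X"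
    using finite_verts verts_eq unfolding stems_def pendants_def by auto
  have inj: "inj_on m (stems G)"
    by (rule inj_on_inverseI[of _ m]) (use stem_mate mate in blast)
  have "m s \<in> M" if "s \<in> stems G" for s using stem_mate[OF that] mate by blast
  then have "X \<inter> m ` stems G = {}" using disjoint by blast
  then have "card X + card (stems G) = card (X \<union> m ` stems G)"
    using fin inj by (simp add: card_Un_disjoint card_image)
  also have "\<dots> \<le> card (pendants G)"
  proof (rule card_mono[OF fin(2)])
    have "m ` stems G \<subseteq> pendants G" using stem_mate pendants_iff by blast
    moreover have "X \<subseteq> pendants G" using extra pendants_iff by blast
    ultimately show "X \<union> m ` stems G \<subseteq> pendants G" by simp
  qed
  finally show ?thesis .
qed

end

section \<open>The lower bound for trees with a mated structure\<close>

locale mated_tree = rooted_tree G r par lev + mated_graph G m M A X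
  for G :: "'a pair_pre_digraph" and r par lev m M A X
begin

text \<open>One vertex of every matched pair, the one farther from the root; adjacent vertices have
  different levels, so exactly one qualifies.\<close>

definition reps :: "'a set" where
  "reps = {v \<in> M. lev (m v) < lev v}"

lemma reps_mate: "v \<in> reps \<Longrightarrow> v \<in> M \<and> m v \<in> M \<and> m v \<notin> reps \<and> m v \<noteq> v"
  using mate unfolding reps_def by auto

lemma lev_arc_neq: "(u, v) \<in> parcs G \<Longrightarrow> lev u \<noteq> lev v"
proof -
  assume "(u, v) \<in> parcs G"
  then consider "u \<in> pverts G" "u \<noteq> r" "par u = v" | "v \<in> pverts G" "v \<noteq> r" "par v = u"
    unfolding arc_iff by blast
  then show ?thesis
  proof cases
    case 1 then show ?thesis using lev_par[OF 1(1,2)] by simp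
  next
    case 2 then show ?thesis using lev_par[OF 2(1,2)] by simp
  qed
qed

lemma mate_reps:
  assumes "v \<in> M" "v \<notin> reps"
  shows "m v \<in> reps"
proof -
  have "(v, m v) \<in> parcs G" using mate[OF assms(1)] unfolding nbrs_def by blast
  then have "lev v \<noteq> lev (m v)" by (rule lev_arc_neq)
  then show ?thesis using assms mate[OF assms(1)] unfolding reps_def by simp
qed

lemma finite_parts: "finite M" "finite A" "finite X" "finite reps"
  using rooted_tree.finite_verts[OF rooted_tree_axioms] verts_eq unfolding reps_def by auto

lemma card_verts: "card (pverts G) = 2 * card reps + card A + card X"
proof -
  have "M = reps \<union> m ` reps"
  proof (intro equalityI subsetI)
    fix v assume v: "v \<in> M"
    show "v \<in> reps \<union> m ` reps"
      using mate_reps[OF v] mate[OF v] by (metis UnI1 UnI2 image_eqI)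
  qed (use reps_mate in auto)
  moreover have "reps \<inter> m ` reps = {}" using reps_mate by auto
  moreover have "card (m ` reps) = card reps"
    by (intro card_image inj_on_inverseI[of _ m]) (use reps_mate mate in blast)
  ultimately have "card M = 2 * card reps"
    using finite_parts(4) by (metis card_Un_disjoint finite_imageI mult_2)
  moreover have "card (pverts G) = card M + card A + card X"
    using verts_eq disjoint finite_parts by (simp add: card_Un_disjoint Int_Un_distrib2)
  ultimately show ?thesis by simp
qed

lemma edge_cases:
  assumes "e \<in> edges G"
  obtains i where "i \<in> reps" "e = {i, m i}" | i u where "i \<in> A \<union> X" "u \<in> nbrs G i" "e = {i, u}"
proof -
  obtain u v where uv: "e = {u, v}" "(u, v) \<in> parcs G" using assms unfolding edges_def by auto
  then have n: "v \<in> nbrs G u" "u \<in> nbrs G v" using nbrs_sym unfolding nbrs_def by auto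
  have V: "u \<in> pverts G" "v \<in> pverts G" using uv arcs_in_verts by auto
  show thesis
  proof (cases "u \<in> A \<union> X \<or> v \<in> A \<union> X")
    case True then show thesis using that(2) n uv by (metis insert_commute)
  next
    case False
    then have uM: "u \<in> M" "v \<in> M" using V verts_eq by auto
    then have v: "v = m u" using mate[OF uM(1)] n by blast
    then show thesis
      using that(1)[of u] that(1)[of v] uv mate[OF uM(1)] mate_reps[OF uM(1)] by (auto simp: insert_commute)
  qed
qed

text \<open>Inside \<open>M\<close> a vertex is adjacent only to its mate, so every other edge ends
  at a connector, of degree 2, or at an extra leaf, of degree 1.\<close>

lemma card_edges_le: "card (edges G) \<le> card reps + 2 * card A + card X"
proof -
  let ?E1 = "(\<lambda>i. {i, m i}) ` reps" and ?E2 = "\<lambda>i. (\<lambda>u. {i, u}) ` nbrs G i"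
  have "edges G \<subseteq> ?E1 \<union> ((\<Union>i\<in>A. ?E2 i) \<union> (\<Union>i\<in>X. ?E2 i))"
  proof
    fix e assume "e \<in> edges G"
    then show "e \<in> ?E1 \<union> ((\<Union>i\<in>A. ?E2 i) \<union> (\<Union>i\<in>X. ?E2 i))" by (cases rule: edge_cases) auto
  qed
  moreover have fin: "finite ?E1" "finite (\<Union>i\<in>A. ?E2 i)" "finite (\<Union>i\<in>X. ?E2 i)"
    using finite_parts rooted_tree.finite_nbrs[OF rooted_tree_axioms] by auto
  ultimately have "card (edges G) \<le> card (?E1 \<union> ((\<Union>i\<in>A. ?E2 i) \<union> (\<Union>i\<in>X. ?E2 i)))"
    by (intro card_mono) auto
  also have "\<dots> \<le> card ?E1 + (card (\<Union>i\<in>A. ?E2 i) + card (\<Union>i\<in>X. ?E2 i))"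
    by (meson card_Un_le add_mono le_trans order_refl)
  also have "card ?E1 \<le> card reps" using finite_parts by (intro card_image_le)
  also have "card (\<Union>i\<in>A. ?E2 i) \<le> 2 * card A"
  proof -
    have "card (\<Union>i\<in>A. ?E2 i) \<le> (\<Sum>i\<in>A. card (?E2 i))" using finite_parts by (intro card_UN_le)
    also have "\<dots> \<le> (\<Sum>i\<in>A. 2)"
    proof (rule sum_mono)
      fix i assume "i \<in> A"
      then show "card (?E2 i) \<le> 2"
        using connector[of i] card_image_le[OF rooted_tree.finite_nbrs[OF rooted_tree_axioms], of "\<lambda>u. {i, u}" i]
        by simp
    qed
    finally show ?thesis by simp
  qed
  also have "card (\<Union>i\<in>X. ?E2 i) \<le> card X"
  proof -
    have "card (\<Union>i\<in>X. ?E2 i) \<le> (\<Sum>i\<in>X. card (?E2 i))" using finite_parts by (intro card_UN_le)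
    also have "\<dots> \<le> (\<Sum>i\<in>X. 1)"
      by (intro sum_mono) (use extra in fastforce)
    finally show ?thesis by simp
  qed
  finally show ?thesis by simp
qed

text \<open>The owners split the vertices and edges into one block for every pair, connector and extra leaf.\<close>

definition owner :: "'a + 'a set \<Rightarrow> 'a" where
  "owner d = (case d of Inl v \<Rightarrow> if v \<in> M - reps then m v else v
     | Inr e \<Rightarrow> if e \<inter> (A \<union> X) = {} then the_elem (e \<inter> reps) else the_elem (e \<inter> (A \<union> X)))"

lemma owner_edge_reps: "i \<in> reps \<Longrightarrow> owner (Inr {i, m i}) = i"
proof -
  assume i: "i \<in> reps"
  have "{i, m i} \<inter> (A \<union> X) = {}" "{i, m i} \<inter> reps = {i}" using reps_mate[OF i] i disjoint by auto
  then show ?thesis unfolding owner_def by simp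
qed

text \<open>Connectors and extra leaves have all their neighbours in \<open>M\<close>. An edge thus
  contains at most one of them, and \<open>the_elem\<close> is applied to a singleton.\<close>

lemma owner_edge:
  assumes "i \<in> A \<union> X" "e \<in> edges G" "i \<in> e"
  shows "owner (Inr e) = i"
proof -
  obtain u where u: "e = {i, u}" "u \<in> nbrs G i"
    using assms(2,3) nbrs_sym unfolding edges_def nbrs_def by blast
  then have "u \<in> M" using connector[of i] extra[of i] assms(1) by auto
  then have "e \<inter> (A \<union> X) = {i}" using u assms(1) disjoint by auto
  then show ?thesis unfolding owner_def by simp
qed

text \<open>In the block of a pair, either the joining edge is chosen and one end with it, or both
  ends are. In the block of a connector, either the connector is chosen and an edge that covers it,
  or both its edges are. An extra leaf needs its edge.\<close>

lemma dominating_pair_card_ge: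
  assumes D: "dominating_pair G D F"
  shows "2 * card reps + 2 * card A + card X \<le> card D + card F"
proof -
  let ?D = "Inl ` D \<union> Inr ` F"
  have fin: "finite D" "finite F" using finite_dominating_pair[OF D] by auto
  have sub: "F \<subseteq> edges G" and cov: "\<And>v. v \<in> pverts G \<Longrightarrow> \<exists>e \<in> F. v \<in> e"
    and vc: "\<And>e. e \<in> edges G \<Longrightarrow> \<exists>v \<in> D. v \<in> e" and ind: "\<And>e. e \<in> edges G \<Longrightarrow> e \<notin> F \<Longrightarrow> e \<subseteq> D"
    using D unfolding dominating_pair_def by auto
  let ?B = "\<lambda>i. {d \<in> ?D. owner d = i}"
  have finB: "finite (?B i)" for i using fin by auto
  have two: "2 \<le> card (?B i)" if "a \<in> ?B i" "b \<in> ?B i" "a \<noteq> b" for a b i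
    using card_mono[OF finB, of "{a, b}" i] that by auto
  have reps2: "2 \<le> card (?B i)" if i: "i \<in> reps" for i
  proof -
    have e: "{i, m i} \<in> edges G" using i reps_mate mate[of i] unfolding edges_def nbrs_def by blast
    have o: "owner (Inl i) = i" "owner (Inl (m i)) = i"
      using i reps_mate[OF i] mate[of i] unfolding owner_def by auto
    show ?thesis
    proof (cases "{i, m i} \<in> F")
      case True
      obtain v where "v \<in> D" "v = i \<or> v = m i" using vc[OF e] by blast
      then show ?thesis using True o owner_edge_reps[OF i]
        by (intro two[of "Inl v" _ "Inr {i, m i}"]) auto
    next
      case False
      then show ?thesis using ind[OF e] o reps_mate[OF i] by (intro two[of "Inl i" _ "Inl (m i)"]) auto
    qed
  qed
  have A2: "2 \<le> card (?B i)" if i: "i \<in> A" for i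
  proof -
    have V: "i \<in> pverts G" using i verts_eq by simp
    have o: "owner (Inl i) = i" using i disjoint unfolding owner_def by auto
    show ?thesis
    proof (cases "i \<in> D")
      case True
      obtain e where e: "e \<in> F" "i \<in> e" using cov[OF V] by blast
      then have "owner (Inr e) = i" using owner_edge i sub by blast
      then show ?thesis using True e o by (intro two[of "Inl i" _ "Inr e"]) auto
    next
      case False
      obtain u v where uv: "nbrs G i = {u, v}" "u \<noteq> v" using connector[OF i] by (auto simp: card_2_iff)
      then have e: "{i, u} \<in> edges G" "{i, v} \<in> edges G" unfolding edges_def nbrs_def by blast+
      then have F: "{i, u} \<in> F" "{i, v} \<in> F" using ind False by blast+
      have ow: "owner (Inr {i, u}) = i" "owner (Inr {i, v}) = i" using owner_edge i e by blast+
      have "{i, u} \<noteq> {i, v}" using uv(2) by (auto simp: doubleton_eq_iff)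
      then show ?thesis using F ow by (intro two[of "Inr {i, u}" _ "Inr {i, v}"]) auto
    qed
  qed
  have X1: "1 \<le> card (?B i)" if i: "i \<in> X" for i
  proof -
    have V: "i \<in> pverts G" using i verts_eq by simp
    obtain e where e: "e \<in> F" "i \<in> e" using cov[OF V] by blast
    then have "owner (Inr e) = i" using owner_edge i sub by blast
    then have "Inr e \<in> ?B i" using e by auto
    then have "card (?B i) > 0" using finB[of i] by (subst card_gt_0_iff) blast
    then show ?thesis by simp
  qed
  let ?I = "reps \<union> A \<union> X"
  have disjI: "(reps \<union> A) \<inter> X = {}" "reps \<inter> A = {}" using disjoint reps_mate by auto
  have "2 * card reps + 2 * card A + card X = (\<Sum>i\<in>reps. 2) + (\<Sum>i\<in>A. 2) + (\<Sum>i\<in>X. 1)"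
    by simp
  also have "\<dots> \<le> (\<Sum>i\<in>reps. card (?B i)) + (\<Sum>i\<in>A. card (?B i)) + (\<Sum>i\<in>X. card (?B i))"
    using reps2 A2 X1 by (intro add_mono sum_mono)
  also have "\<dots> = (\<Sum>i\<in>?I. card (?B i))"
    using finite_parts disjI by (simp add: sum.union_disjoint)
  also have "\<dots> = card (\<Union>i\<in>?I. ?B i)"
    using finite_parts finB by (intro card_UN_disjoint[symmetric]) auto
  also have "\<dots> \<le> card ?D" using fin by (intro card_mono) auto
  finally show ?thesis using card_Inl_Un_Inr[OF fin] by simp
qed

text \<open>Write R, A, X for the sizes of \<open>reps\<close>, \<open>A\<close>, \<open>X\<close>.
  Then n = 2R + A + X and n - 1 \<le> R + 2A + X. Twice the sum gives 4n - 2 \<le> 6R + 6A + 4X,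
  where 6R + 6A + 3X is at most three times the domination number and the remaining X is at most the
  number of pendants minus that of stems.\<close>

lemma gamma_lower_bound:
  assumes "pverts G \<noteq> {r}"
  shows "4 * card (pverts G) + card (stems G) \<le> 3 * gamma_t_oi (subdivision_graph G) + card (pendants G) + 2"
proof -
  obtain D F where "dominating_pair G D F" "gamma_t_oi (subdivision_graph G) = card D + card F"
    using gamma_attained[OF assms] .
  then show ?thesis
    using dominating_pair_card_ge[of D F] card_edges_le card_edges card_verts card_extra_stems_le by linarith
qed

end

section \<open>The operations preserve the mated structure\<close>

lemma attach_leaf_simps:
  "pverts (attach_path T v [w]) = insert w (pverts T)"
  "parcs (attach_path T v [w]) = parcs T \<union> {(v, w), (w, v)}"
  by (auto simp: attach_path_def path_graph_def)

lemma attach_3_simps: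
  "pverts (attach_path T v [a, b, c]) = pverts T \<union> {a, b, c}"
  "parcs (attach_path T v [a, b, c]) =
     parcs T \<union> {(a, b), (b, a), (b, c), (c, b), (v, a), (a, v)}"
  by (auto simp: attach_path_def path_graph_def)

lemma path_graph_2_simps:
  "pverts (path_graph [u, v]) = {u, v}" "parcs (path_graph [u, v]) = {(u, v), (v, u)}"
  by (auto simp: path_graph_def)

context mated_graph
begin

text \<open>These are the vertices to which a \<open>P\<^sub>3\<close> can be attached without destroying the structure.\<close>

definition free :: "'a \<Rightarrow> bool" where
  "free v \<longleftrightarrow> v \<in> M \<and> (\<forall>x \<in> X. m v \<notin> nbrs G x)"

lemma nbrs_outside: "w \<notin> pverts G \<Longrightarrow> nbrs G w = {}"
  unfolding nbrs_def using arcs_subset by auto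

text \<open>The mate of a stem is already a leaf, which is what the condition on \<open>X\<close>
  demands at the vertex carrying the new extra leaf.\<close>

lemma attach_leaf:
  assumes v: "v \<in> stems G" and w: "w \<notin> pverts G"
  shows "mated_graph (attach_path G v [w]) m M A (insert w X)"
proof -
  let ?H = "attach_path G v [w]"
  have vM: "v \<in> M" "nbrs G (m v) = {v}" using stem_mate[OF v] by simp_all
  have vV: "v \<in> pverts G" using vM verts_eq by simp
  have nb: "nbrs ?H u = (if u = v then insert w (nbrs G v) else if u = w then {v} else nbrs G u)" for u
    using w vV nbrs_outside[OF w] unfolding nbrs_def attach_leaf_simps by auto
  have wn: "w \<notin> M" "w \<notin> A" "w \<notin> X" using w verts_eq by auto
  show ?thesis
  proof
    show "finite (pverts ?H)" using finite_verts unfolding attach_leaf_simps by simp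
    show "parcs ?H \<subseteq> pverts ?H \<times> pverts ?H" using arcs_subset vV unfolding attach_leaf_simps by auto
    show "(u, u') \<in> parcs ?H \<Longrightarrow> (u', u) \<in> parcs ?H" for u u'
      using arcs_sym unfolding attach_leaf_simps by auto
    show "pverts ?H = M \<union> A \<union> insert w X" using verts_eq unfolding attach_leaf_simps by auto
    show "M \<inter> A = {}" "M \<inter> insert w X = {}" "A \<inter> insert w X = {}" using disjoint wn by auto
    show "m u \<in> M \<and> m u \<noteq> u \<and> m (m u) = u \<and> nbrs ?H u \<inter> M = {m u}" if "u \<in> M" for u
      using mate[OF that] that wn unfolding nb by auto
    show "card (nbrs ?H a) = 2 \<and> nbrs ?H a \<subseteq> M" if "a \<in> A" for a
    proof -
      have "a \<noteq> v" "a \<noteq> w" using that vM wn disjoint by auto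
      then show ?thesis using connector[OF that] unfolding nb by simp
    qed
    have mv: "m v \<noteq> v" "m v \<noteq> w" using mate[OF vM(1)] wn by auto
    show "\<exists>u \<in> M. nbrs ?H x = {u} \<and> nbrs ?H (m u) = {u}" if "x \<in> insert w X" for x
    proof (cases "x = w")
      case True
      have "nbrs ?H w = {v} \<and> nbrs ?H (m v) = {v}" using vM mv w vV unfolding nb by auto
      then show ?thesis using vM True by blast
    next
      case False
      then have xX: "x \<in> X" using that by simp
      then obtain u where u: "u \<in> M" "nbrs G x = {u}" "nbrs G (m u) = {u}" using extra by blast
      have "x \<noteq> v" using xX vM disjoint by auto
      \<comment> \<open>Otherwise \<open>u\<close> would be the mate of the stem \<open>v\<close>,
        hence a leaf, although both \<open>v\<close> and \<open>x\<close> are its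
        neighbours.\<close>
      moreover have "m u \<noteq> v"
      proof
        assume "m u = v"
        then have "m v = u" using mate[OF u(1)] by auto
        then have "nbrs G u = {v}" using vM by simp
        moreover have "x \<in> nbrs G u" using u(2) nbrs_sym[of u x] by simp
        ultimately show False using \<open>x \<noteq> v\<close> by simp
      qed
      moreover have "m u \<noteq> w" using mate[OF u(1)] wn by auto
      ultimately have "nbrs ?H x = {u} \<and> nbrs ?H (m u) = {u}" using u False unfolding nb by simp
      then show ?thesis using u by blast
    qed
  qed
qed

text \<open>The vertex \<open>a\<close> becomes a connector between \<open>v\<close> and the new
  pair of \<open>b\<close> and \<open>c\<close>. Freeness of \<open>v\<close> means that no extra
  leaf relies on \<open>v\<close> being a leaf. It survives because \<open>X\<close> and the mate of
  \<open>v\<close> do not change, so several paths can be attached at \<open>v\<close>.\<close>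

lemma attach_3:
  assumes v: "free v" and abc: "distinct [a, b, c]" "{a, b, c} \<inter> pverts G = {}"
  defines "H \<equiv> attach_path G v [a, b, c]" and "m' \<equiv> m(b := c, c := b)"
  shows "mated_graph H m' (M \<union> {b, c}) (insert a A) X"
    and "mated_graph.free H m' (M \<union> {b, c}) X v"
proof -
  have vM: "v \<in> M" and fr: "\<And>x. x \<in> X \<Longrightarrow> m v \<notin> nbrs G x" using v unfolding free_def by auto
  have vV: "v \<in> pverts G" using vM verts_eq by simp
  have out: "a \<notin> pverts G" "b \<notin> pverts G" "c \<notin> pverts G" using abc by auto
  then have vn: "v \<noteq> a" "v \<noteq> b" "v \<noteq> c" using vV by auto
  have nbH: "nbrs H u = nbrs G u \<union> {w. (u, w) \<in> {(a, b), (b, a), (b, c), (c, b), (v, a), (a, v)}}" for u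
    unfolding nbrs_def H_def attach_3_simps by auto
  have nb: "nbrs H u = (if u = v then insert a (nbrs G v) else if u = a then {v, b}
      else if u = b then {a, c} else if u = c then {b} else nbrs G u)" for u
    using nbrs_outside[OF out(1)] nbrs_outside[OF out(2)] nbrs_outside[OF out(3)] vn abc(1)
    unfolding nbH by (cases "u = v"; cases "u = a"; cases "u = b"; cases "u = c") auto
  have mem: "a \<notin> M" "a \<notin> A" "a \<notin> X" "b \<notin> M" "b \<notin> A" "b \<notin> X" "c \<notin> M" "c \<notin> A" "c \<notin> X"
    using out verts_eq by auto
  have m'M: "m' u = m u" if "u \<in> M" for u using that mem unfolding m'_def by auto
  have old: "u \<noteq> a \<and> u \<noteq> b \<and> u \<noteq> c" if "u \<in> pverts G" for u using that out by auto
  have nbX: "nbrs H x = nbrs G x" if "x \<in> X" for x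
    using that vM disjoint mem unfolding nb by auto
  show mated: "mated_graph H m' (M \<union> {b, c}) (insert a A) X"
  proof
    show "finite (pverts H)" using finite_verts unfolding H_def attach_3_simps by simp
    show "parcs H \<subseteq> pverts H \<times> pverts H"
      using arcs_subset vV unfolding H_def attach_3_simps by (intro Un_least) blast+
    show "(u, u') \<in> parcs H \<Longrightarrow> (u', u) \<in> parcs H" for u u'
      using arcs_sym[of u u'] unfolding H_def attach_3_simps by blast
    show "pverts H = M \<union> {b, c} \<union> insert a A \<union> X" using verts_eq unfolding H_def attach_3_simps by blast
    show "(M \<union> {b, c}) \<inter> insert a A = {}" "(M \<union> {b, c}) \<inter> X = {}" "insert a A \<inter> X = {}"
      using disjoint mem abc by auto
    show "m' u \<in> M \<union> {b, c} \<and> m' u \<noteq> u \<and> m' (m' u) = u \<and> nbrs H u \<inter> (M \<union> {b, c}) = {m' u}"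
      if "u \<in> M \<union> {b, c}" for u
    proof -
      consider "u = b" | "u = c" | "u \<in> M" using \<open>u \<in> M \<union> {b, c}\<close> by blast
      then show ?thesis
      proof cases
        case 1 then show ?thesis using abc vn mem unfolding nb m'_def by auto
      next
        case 2 then show ?thesis using abc vn mem unfolding nb m'_def by auto
      next
        case 3
        then have uo: "u \<noteq> a" "u \<noteq> b" "u \<noteq> c" using mem by auto
        have "nbrs G u \<inter> {a, b, c} = {}" using out nbrs_subset by blast
        then have "nbrs H u \<inter> (M \<union> {b, c}) = nbrs G u \<inter> M"
          using uo mem abc unfolding nb by auto
        then show ?thesis using mate[OF 3] m'M 3 by simp
      qed
    qed
    show "card (nbrs H u) = 2 \<and> nbrs H u \<subseteq> M \<union> {b, c}" if "u \<in> insert a A" for u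
    proof (cases "u = a")
      case True then show ?thesis using vn vM unfolding nb by auto
    next
      case False
      then have uA: "u \<in> A" using that by simp
      then have "u \<noteq> v" "u \<noteq> b" "u \<noteq> c" using vM mem disjoint by auto
      then show ?thesis using connector[OF uA] False unfolding nb by auto
    qed
    show "\<exists>u \<in> M \<union> {b, c}. nbrs H x = {u} \<and> nbrs H (m' u) = {u}" if "x \<in> X" for x
    proof -
      obtain u where u: "u \<in> M" "nbrs G x = {u}" "nbrs G (m u) = {u}"
        using extra[OF \<open>x \<in> X\<close>] by blast
      have "m u \<noteq> v" using fr[OF that] u(1,2) mate[OF u(1)] by auto
      moreover have "m u \<in> pverts G" using mate[OF u(1)] verts_eq by auto
      ultimately have "nbrs H (m u) = {u}" using u old[of "m u"] unfolding nb by simp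
      then show ?thesis using u m'M nbX[OF that] by auto
    qed
  qed
  then interpret H: mated_graph H m' "M \<union> {b, c}" "insert a A" X .
  show "H.free v" unfolding H.free_def using vM m'M fr nbX by simp
qed

lemma free_stem: "v \<in> stems G \<Longrightarrow> free v"
proof -
  assume v: "v \<in> stems G"
  have "m v \<notin> nbrs G x" if "x \<in> X" for x
  proof
    assume "m v \<in> nbrs G x"
    then have "x \<in> nbrs G (m v)" by (rule nbrs_sym[THEN iffD1])
    then show False using stem_mate[OF v] that disjoint by auto
  qed
  then show ?thesis using stem_mate[OF v] unfolding free_def by simp
qed

lemma leaves_subset: "leaves G \<subseteq> pendants G"
proof (cases "card (pverts G) = 2")
  case True
  define v where "v = (SOME v. v \<in> pverts G)"
  have "\<exists>v. v \<in> pverts G" using True by (cases "pverts G = {}") auto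
  then have v: "v \<in> pverts G" unfolding v_def by (rule someI_ex)
  have "card (nbrs G v) \<le> card (pverts G - {v})" using nbrs_subset finite_verts by (intro card_mono) simp_all
  moreover have "card (nbrs G v) > 0" using nbrs_nonempty[OF v] finite_nbrs by (simp add: card_gt_0_iff)
  ultimately have "card (nbrs G v) = 1" using True v finite_verts by simp
  then have "v \<in> pendants G" using v by (simp add: pendants_def)
  then show ?thesis unfolding leaves_def v_def[symmetric] using True by simp
qed (simp add: leaves_def pendants_def)

lemma support_subset: "support G \<subseteq> stems G"
  unfolding support_def stems_def using leaves_subset by auto

text \<open>Three distinct vertices are involved, so the convention for the path on two vertices
  does not interfere.\<close>

lemma strong_leaf:
  assumes "v \<in> pendants G" "y \<in> pendants G" "v \<noteq> y" "nbrs G v = {z}" "nbrs G y = {z}"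
  shows "v \<in> strong_leaves G"
proof -
  have z: "v \<in> nbrs G z" "y \<in> nbrs G z" using assms(4,5) nbrs_sym[of v z] nbrs_sym[of y z] by simp_all
  have V: "v \<in> pverts G" "y \<in> pverts G" "z \<in> pverts G" "z \<noteq> v" "z \<noteq> y"
    using assms nbrs_subset[of v] nbrs_subset[of y] unfolding pendants_def by auto
  have "card {v, y, z} \<le> card (pverts G)" using V finite_verts by (intro card_mono) auto
  then have "card (pverts G) \<noteq> 2" using V assms(3) by simp
  then have L: "leaves G = pendants G" by (simp add: leaves_def pendants_def)
  have sz: "z \<in> support G" unfolding support_def using V(3) z(1) assms(1) L by blast
  have "card {v, y} \<le> card (nbrs G z \<inter> leaves G)"
    using z assms L finite_nbrs by (intro card_mono) auto
  then have "z \<in> strong_support G" unfolding strong_support_def using sz assms(3) by simp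
  then show ?thesis unfolding strong_leaves_def using assms L by simp
qed

text \<open>A leaf in \<open>X\<close>, or a matched leaf whose mate carries an extra leaf, shares
  its neighbour with a second leaf and is therefore strong.\<close>

lemma free_weak_leaf:
  assumes "v \<in> weak_leaves G"
  shows "free v"
proof -
  have v: "v \<in> leaves G" "v \<notin> strong_leaves G" using assms unfolding weak_leaves_def by auto
  then have vp: "v \<in> pendants G" using leaves_subset by auto
  then obtain z where z: "nbrs G v = {z}" using pendants_iff by blast
  have "v \<in> pverts G" using vp unfolding pendants_def by simp
  moreover have "v \<notin> A" using connector[of v] z by auto
  moreover have "v \<notin> X"
  proof
    assume vX: "v \<in> X"
    then obtain u where u: "u \<in> M" "nbrs G v = {u}" "nbrs G (m u) = {u}" using extra by blast
    have "v \<noteq> m u" using mate[OF u(1)] vX disjoint by auto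
    then show False using strong_leaf[of v "m u" z] vp u z pendants_iff v(2) by auto
  qed
  ultimately have vM: "v \<in> M" using verts_eq by auto
  then have mz: "m v = z" using mate[OF vM] z by auto
  have "m v \<notin> nbrs G x" if xX: "x \<in> X" for x
  proof
    assume "m v \<in> nbrs G x"
    then have "nbrs G x = {z}" using extra[OF xX] mz by auto
    moreover have "v \<noteq> x" using vM xX disjoint by auto
    ultimately show False using strong_leaf[of v x z] vp z pendants_iff v(2) by auto
  qed
  then show ?thesis using vM unfolding free_def by simp
qed

end

lemma pverts_foldr_attach_path:
  "pverts (foldr (\<lambda>p H. attach_path H v p) ps T) = pverts T \<union> set (concat ps)"
  by (induction ps) (auto simp: attach_path_def path_graph_def)

lemma parcs_foldr_attach_path:
  "parcs (foldr (\<lambda>p H. attach_path H v p) ps T) =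
     parcs T \<union> (\<Union>p \<in> set ps. parcs (path_graph p) \<union> {(v, hd p), (hd p, v)})"
  by (induction ps) (auto simp: attach_path_def)

text \<open>Turns \<open>O3\<close> into repeated attachment of paths at \<open>v\<close>, so that
  one induction over a list of paths serves both \<open>O2\<close> and \<open>O3\<close>.\<close>

lemma union_attach_paths:
  assumes "v \<in> pverts T"
  shows "\<lparr> pverts = pverts T \<union> pverts (foldr (\<lambda>p H. attach_path H v p) ps (path_graph [v])),
     parcs = parcs T \<union> parcs (foldr (\<lambda>p H. attach_path H v p) ps (path_graph [v])) \<rparr>
   = foldr (\<lambda>p H. attach_path H v p) ps T"
proof (rule pair_pre_digraph.equality)
  have "parcs (path_graph [v]) = {}" "pverts (path_graph [v]) = {v}" by (simp_all add: path_graph_def)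
  then show "parcs \<lparr> pverts = pverts T \<union> pverts (foldr (\<lambda>p H. attach_path H v p) ps (path_graph [v])),
     parcs = parcs T \<union> parcs (foldr (\<lambda>p H. attach_path H v p) ps (path_graph [v])) \<rparr>
   = parcs (foldr (\<lambda>p H. attach_path H v p) ps T)"
    "pverts \<lparr> pverts = pverts T \<union> pverts (foldr (\<lambda>p H. attach_path H v p) ps (path_graph [v])),
     parcs = parcs T \<union> parcs (foldr (\<lambda>p H. attach_path H v p) ps (path_graph [v])) \<rparr>
   = pverts (foldr (\<lambda>p H. attach_path H v p) ps T)"
    using assms unfolding parcs_foldr_attach_path pverts_foldr_attach_path by auto
qed simp

lemma mated_foldr_attach_path:
  assumes "mated_graph G m M A X" "mated_graph.free G m M X v"
    and "\<forall>p \<in> set ps. length p = 3" "distinct (concat ps)" "set (concat ps) \<inter> pverts G = {}"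
  shows "\<exists>m M A X. mated_graph (foldr (\<lambda>p H. attach_path H v p) ps G) m M A X \<and>
    mated_graph.free (foldr (\<lambda>p H. attach_path H v p) ps G) m M X v"
  using assms(3-)
proof (induction ps)
  case Nil
  then show ?case using assms(1,2) by auto
next
  case (Cons p ps)
  let ?H = "foldr (\<lambda>p H. attach_path H v p) ps G"
  have "\<forall>p \<in> set ps. length p = 3" "distinct (concat ps)" "set (concat ps) \<inter> pverts G = {}"
    using Cons.prems by auto
  from Cons.IH[OF this] obtain m M A X
    where H: "mated_graph ?H m M A X" "mated_graph.free ?H m M X v" by blast
  obtain a b c where p: "p = [a, b, c]" using Cons.prems(1)
    by (auto simp: length_Suc_conv numeral_3_eq_3)
  have "distinct [a, b, c]" using Cons.prems p by simp
  moreover have "{a, b, c} \<inter> pverts ?H = {}"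
    using Cons.prems unfolding p pverts_foldr_attach_path by auto
  ultimately show ?case
    using mated_graph.attach_3[OF H(1,2), of a b c] unfolding p foldr.simps o_apply by blast
qed

lemma digraph_iso_with_projE:
  assumes "digraph_iso (with_proj T) (with_proj T')"
  obtains f where "inj_on f (pverts T)" "pverts T' = f ` pverts T" "parcs T' = map_prod f f ` parcs T"
proof -
  obtain h where h: "pre_digraph.digraph_isomorphism (with_proj T) h" "with_proj T' = app_iso h (with_proj T)"
    using assms unfolding digraph_iso_def by blast
  let ?f = "iso_verts h"
  \<comment> \<open>An isomorphism of digraphs carries separate maps for arcs, tails and heads. Both
    digraphs have the projections as tail and head, which forces the arc map to apply the vertex map
    to both components.\<close>
  have t: "iso_tail h = fst" "iso_head h = snd"
    using arg_cong[OF h(2), of tail] arg_cong[OF h(2), of head] by simp_all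
  have "pverts T' = ?f ` pverts T" "parcs T' = iso_arcs h ` parcs T"
    using arg_cong[OF h(2), of verts] arg_cong[OF h(2), of arcs] by simp_all
  moreover have "iso_arcs h e = map_prod ?f ?f e" if "e \<in> parcs T" for e
    using h(1) that t unfolding pre_digraph.digraph_isomorphism_def by (cases e) (auto simp: prod_eq_iff)
  then have "iso_arcs h ` parcs T = map_prod ?f ?f ` parcs T" by (intro image_cong) auto
  moreover have "inj_on ?f (pverts T)"
    using h(1) unfolding pre_digraph.digraph_isomorphism_def by simp
  ultimately show thesis using that by metis
qed

lemma mated_graph_image:
  assumes "mated_graph T m M A X" and f: "inj_on f (pverts T)"
    and T': "pverts T' = f ` pverts T" "parcs T' = map_prod f f ` parcs T"
  shows "mated_graph T' (f \<circ> m \<circ> inv_into (pverts T) f) (f ` M) (f ` A) (f ` X)"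
proof -
  interpret mated_graph T m M A X by fact
  have inv: "inv_into (pverts T) f (f v) = v" if "v \<in> pverts T" for v
    using f that by simp
  have feq: "f u = f v \<longleftrightarrow> u = v" if "u \<in> pverts T" "v \<in> pverts T" for u v
    using f that by (auto dest: inj_onD)
  have nb: "nbrs T' (f v) = f ` nbrs T v" if "v \<in> pverts T" for v
  proof (intro equalityI subsetI)
    fix w assume "w \<in> nbrs T' (f v)"
    then obtain a b where ab: "(a, b) \<in> parcs T" "f a = f v" "w = f b"
      unfolding nbrs_def T' by auto
    then have "a = v" using feq arcs_subset that by auto
    then show "w \<in> f ` nbrs T v" using ab unfolding nbrs_def by auto
  qed (auto simp: nbrs_def T')
  have sub: "M \<subseteq> pverts T" "A \<subseteq> pverts T" "X \<subseteq> pverts T" using verts_eq by auto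
  have int: "f ` B \<inter> f ` C = f ` (B \<inter> C)" if "B \<subseteq> pverts T" "C \<subseteq> pverts T" for B C
    using inj_on_image_Int[OF f that] by simp
  have nsub: "nbrs T v \<subseteq> pverts T" for v using nbrs_subset by blast
  show ?thesis
  proof
    show "finite (pverts T')" using finite_verts T' by simp
    show "parcs T' \<subseteq> pverts T' \<times> pverts T'" using arcs_subset T' by auto
    show "(u, v) \<in> parcs T' \<Longrightarrow> (v, u) \<in> parcs T'" for u v using arcs_sym T' by auto
    show "pverts T' = f ` M \<union> f ` A \<union> f ` X" using T' verts_eq by auto
    show "f ` M \<inter> f ` A = {}" "f ` M \<inter> f ` X = {}" "f ` A \<inter> f ` X = {}"
      using sub int disjoint by simp_all
    show "(f \<circ> m \<circ> inv_into (pverts T) f) u \<in> f ` M \<and> (f \<circ> m \<circ> inv_into (pverts T) f) u \<noteq> u \<and>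
        (f \<circ> m \<circ> inv_into (pverts T) f) ((f \<circ> m \<circ> inv_into (pverts T) f) u) = u \<and>
        nbrs T' u \<inter> f ` M = {(f \<circ> m \<circ> inv_into (pverts T) f) u}" if u: "u \<in> f ` M" for u
    proof -
      obtain v where v: "v \<in> M" "u = f v" using u by blast
      then have V: "v \<in> pverts T" "m v \<in> pverts T" using mate[OF v(1)] sub by auto
      have "nbrs T' u \<inter> f ` M = f ` (nbrs T v \<inter> M)" using v V nb int nsub sub by simp
      then show ?thesis using mate[OF v(1)] v V inv feq by simp
    qed
    show "card (nbrs T' a) = 2 \<and> nbrs T' a \<subseteq> f ` M" if a: "a \<in> f ` A" for a
    proof -
      obtain v where v: "v \<in> A" "a = f v" using a by blast
      then have "nbrs T' a = f ` nbrs T v" using nb sub by auto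
      then show ?thesis using connector[OF v(1)] card_image[OF inj_on_subset[OF f nsub]] by auto
    qed
    show "\<exists>v \<in> f ` M. nbrs T' x = {v} \<and> nbrs T' ((f \<circ> m \<circ> inv_into (pverts T) f) v) = {v}"
      if x: "x \<in> f ` X" for x
    proof -
      obtain y where y: "y \<in> X" "x = f y" using x by blast
      obtain v where v: "v \<in> M" "nbrs T y = {v}" "nbrs T (m v) = {v}" using extra[OF y(1)] by blast
      have V: "v \<in> pverts T" "m v \<in> pverts T" "y \<in> pverts T" using mate[OF v(1)] v y sub by auto
      then show ?thesis using v y nb inv by (intro bexI[of _ "f v"]) auto
    qed
  qed
qed

lemma tree_family_mated:
  "T \<in> tree_family \<Longrightarrow> \<exists>m M A X. mated_graph T m M A X"
proof (induction rule: tree_family.induct)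
  case (P2 u v)
  have "mated_graph (path_graph [u, v]) (\<lambda>x. if x = u then v else u) {u, v} {} {}"
    by unfold_locales (use P2 in \<open>auto simp: path_graph_2_simps nbrs_def\<close>)
  then show ?case by blast
next
  case (O1 T v w)
  then obtain m M A X where T: "mated_graph T m M A X" by blast
  then show ?case using O1 mated_graph.attach_leaf[OF T] mated_graph.support_subset[OF T] by blast
next
  case (O2 T v ws)
  then obtain m M A X where T: "mated_graph T m M A X" by blast
  have "mated_graph.free T m M X v"
    using O2(2) mated_graph.free_stem[OF T] mated_graph.free_weak_leaf[OF T]
      mated_graph.support_subset[OF T] by blast
  then show ?case using mated_foldr_attach_path[OF T, of v "[ws]"] O2 by auto
next
  case (O3 T v r Q)
  then obtain m M A X where T: "mated_graph T m M A X" by blast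
  obtain ps where ps: "\<forall>p \<in> set ps. length p = 3" "distinct (v # concat ps)"
      "Q = foldr (\<lambda>p H. attach_path H v p) ps (path_graph [v])"
    using O3(4) unfolding is_Q_def by blast
  have fr: "mated_graph.free T m M X v" using O3(2) mated_graph.free_weak_leaf[OF T] by blast
  have "pverts Q = insert v (set (concat ps))"
    unfolding ps(3) pverts_foldr_attach_path by (simp add: path_graph_def)
  then have disj: "set (concat ps) \<inter> pverts T = {}" and v: "v \<in> pverts T" using O3(5) ps(2) by auto
  have "\<lparr> pverts = pverts T \<union> pverts Q, parcs = parcs T \<union> parcs Q \<rparr>
      = foldr (\<lambda>p H. attach_path H v p) ps T"
    unfolding ps(3) using v by (rule union_attach_paths)
  then show ?case using mated_foldr_attach_path[OF T fr ps(1)] ps(2) disj by auto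
next
  case (iso T T')
  then obtain m M A X where T: "mated_graph T m M A X" by blast
  show ?case using iso(2) by (rule digraph_iso_with_projE) (use mated_graph_image[OF T] in blast)
qed

section \<open>The upper bound for all trees, and the path on two vertices\<close>

context rooted_tree
begin

lemma exists_stem:
  assumes "pverts G \<noteq> {r}"
  shows "stems G \<noteq> {}"
proof -
  obtain y where y: "y \<in> pverts G" "y \<noteq> r" "\<And>u. u \<in> pverts G \<Longrightarrow> u \<noteq> r \<Longrightarrow> par u \<noteq> y"
    using obtain_deepest[OF assms] by metis
  then have "kids y = {}" unfolding kids_def by auto
  then have "y \<in> pendants G" using pendant_nonroot_iff[OF y(1,2)] by simp
  moreover have "y \<in> nbrs G (par y)" using y(1,2) par_in_verts arc_iff unfolding nbrs_def by auto
  ultimately show ?thesis using par_in_verts[OF y(1,2)] unfolding stems_def by blast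
qed

lemma two_verts:
  assumes "card (pverts G) = 2"
  obtains y where "y \<noteq> r" "pverts G = {r, y}" "parcs G = {(r, y), (y, r)}"
proof -
  obtain y where y: "y \<noteq> r" "pverts G = {r, y}"
    using assms root_in_verts unfolding card_2_iff by (metis insertE insert_commute singletonD)
  then have py: "par y = r" using par_in_verts[of y] par_neq[of y] by auto
  have "parcs G = {(r, y), (y, r)}"
    using py y by (intro equalityI subrelI) (auto simp: arc_iff)
  then show thesis using that y by blast
qed

lemma exists_stem_root:
  assumes "3 \<le> card (pverts G)"
  shows "\<exists>r par lev. stem_rooted_tree G r par lev"
proof -
  have "pverts G \<noteq> {r}" using assms by auto
  then obtain s where s: "s \<in> stems G" using exists_stem by auto
  then obtain p l where "rooted_tree G s p l"
    using rooted_tree_reroot[OF rooted_tree_axioms, of s] unfolding stems_def by auto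
  then have "stem_rooted_tree G s p l"
    using s assms by (simp add: stem_rooted_tree_def stem_rooted_tree_axioms_def)
  then show ?thesis by blast
qed

text \<open>In the path on two vertices both vertices are pendants and stems, so the phases do not
  apply; one vertex together with the edge meets the bound directly.\<close>

lemma upper_bound:
  assumes "2 \<le> card (pverts G)"
  shows "3 * gamma_t_oi (subdivision_graph G) + card (pendants G) + 2 \<le> 4 * card (pverts G) + card (stems G)"
proof (cases "card (pverts G) = 2")
  case True
  then obtain y where y: "y \<noteq> r" "pverts G = {r, y}" "parcs G = {(r, y), (y, r)}" by (rule two_verts)
  have nb: "nbrs G r = {y}" "nbrs G y = {r}" using y unfolding nbrs_def by auto
  then have P: "pendants G = {r, y}" using y unfolding pendants_def by auto
  then have S: "stems G = {r, y}" using y nb unfolding stems_def by auto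
  have k: "kids r = {y}" using nb nbrs_root by simp
  then have "par y = r" using kids_iff by blast
  then have "gamma_t_oi (subdivision_graph G) \<le> card {r} + card {y}"
    using y k by (intro gamma_le_parent_set) auto
  then show ?thesis using P S True y(1) by simp
next
  case False
  then have "3 \<le> card (pverts G)" using assms by simp
  then obtain r' p l where "stem_rooted_tree G r' p l" using exists_stem_root by blast
  then show ?thesis by (rule stem_rooted_tree.gamma_upper_bound)
qed

end

text \<open>Removing a branch can leave a path on two vertices, whose leaf is an arbitrary choice.
  This leaf is weak, so \<open>O2\<close> may use either vertex whatever the choice is.\<close>

lemma two_verts_family:
  assumes "rooted_tree T r par lev" "card (pverts T) = 2"
  shows "T \<in> tree_family" "support T \<union> weak_leaves T = pverts T"
    "card (leaves T) = 1" "card (support T) = 1" "pendants T = pverts T" "stems T = pverts T"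
proof -
  interpret rooted_tree T r par lev by fact
  obtain y where y: "y \<noteq> r" "pverts T = {r, y}" "parcs T = {(r, y), (y, r)}"
    using two_verts[OF assms(2)] .
  have "T = path_graph [r, y]" using y by (intro pair_pre_digraph.equality) (auto simp: path_graph_2_simps)
  then show "T \<in> tree_family" using tree_family.P2[of r y] y by simp
  have nb: "nbrs T r = {y}" "nbrs T y = {r}" using y unfolding nbrs_def by auto
  then show P: "pendants T = pverts T" using y unfolding pendants_def by auto
  then show "stems T = pverts T" using y nb unfolding stems_def by auto
  define u where "u = (SOME v. v \<in> pverts T)"
  have "u \<in> pverts T" unfolding u_def using root_in_verts by (rule someI)
  then consider "u = r" | "u = y" using y(2) by blast
  then obtain w where w: "pverts T = {u, w}" "u \<noteq> w" "nbrs T u = {w}" "nbrs T w = {u}"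
  proof cases
    case 1 then show thesis using that[of y] y(1,2) nb by simp
  next
    case 2 then show thesis using that[of r] y(1,2) nb by (simp add: insert_commute)
  qed
  have "leaves T = {u}" unfolding leaves_def u_def[symmetric] using assms(2) by simp
  note uw = this w
  then have sup: "support T = {w}" unfolding support_def by auto
  then show "card (support T) = 1" "card (leaves T) = 1" using uw by simp_all
  have "strong_support T = {}" unfolding strong_support_def sup using uw by auto
  then have "weak_leaves T = {u}" unfolding weak_leaves_def strong_leaves_def uw(1) by simp
  then show "support T \<union> weak_leaves T = pverts T" unfolding sup uw(2) by auto
qed

lemma leaves_eq_pendants: "card (pverts T) \<noteq> 2 \<Longrightarrow> leaves T = pendants T"
  by (simp add: leaves_def pendants_def)

lemma support_eq_stems: "card (pverts T) \<noteq> 2 \<Longrightarrow> support T = stems T"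
  unfolding support_def stems_def leaves_eq_pendants[of T] by auto

subsection \<open>Removing branches and leaves\<close>

text \<open>The set \<open>B\<close> is a parameter because one branch is removed if
  \<open>x\<close> is a stem, but all branches below \<open>x\<close> if \<open>x\<close> is
  inner.\<close>

locale branched_tree = rooted_tree G r par lev
  for G :: "'a pair_pre_digraph" and r par lev +
  fixes x :: 'a and B :: "'a set" and f g :: "'a \<Rightarrow> 'a"
  assumes branch: "a \<in> B \<Longrightarrow> a \<in> kids x \<and> kids a = {f a} \<and> kids (f a) = {g a} \<and> kids (g a) = {}"
    and x_in_verts: "x \<in> pverts G"
    and x_not_pendant: "x \<notin> pendants G"
begin

definition branch_verts :: "'a set" where "branch_verts = B \<union> f ` B \<union> g ` B"

definition trunk :: "'a pair_pre_digraph" where "trunk = induced G (pverts G - branch_verts)"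

lemma branch_vert:
  assumes "a \<in> B"
  shows "a \<in> pverts G" "a \<noteq> r" "par a = x" "f a \<in> pverts G" "f a \<noteq> r" "par (f a) = a"
    "g a \<in> pverts G" "g a \<noteq> r" "par (g a) = f a"
    "lev a = Suc (lev x)" "lev (f a) = Suc (Suc (lev x))" "lev (g a) = Suc (Suc (Suc (lev x)))"
proof -
  have k: "a \<in> kids x" "f a \<in> kids a" "g a \<in> kids (f a)" using branch[OF assms] by auto
  then show "a \<in> pverts G" "a \<noteq> r" "par a = x" "f a \<in> pverts G" "f a \<noteq> r" "par (f a) = a"
    "g a \<in> pverts G" "g a \<noteq> r" "par (g a) = f a" unfolding kids_iff by simp_all
  show "lev a = Suc (lev x)" "lev (f a) = Suc (Suc (lev x))" "lev (g a) = Suc (Suc (Suc (lev x)))"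
    using lev_kids[OF k(1)] lev_kids[OF k(2)] lev_kids[OF k(3)] by simp_all
qed

lemma finite_B: "finite B"
  by (rule finite_subset[OF _ finite_verts]) (use branch_vert(1) in blast)

lemma inj_f: "inj_on f B" and inj_g: "inj_on g B"
proof -
  show "inj_on f B" by (rule inj_on_inverseI[of _ par]) (rule branch_vert(6))
  show "inj_on g B" by (rule inj_on_inverseI[of _ "par \<circ> par"]) (simp add: branch_vert)
qed

lemma branch_disjoint: "B \<inter> f ` B = {}" "B \<inter> g ` B = {}" "f ` B \<inter> g ` B = {}"
proof -
  have "lev b \<noteq> lev (f a)" "lev b \<noteq> lev (g a)" "lev (f b) \<noteq> lev (g a)" if "a \<in> B" "b \<in> B" for a b
    using branch_vert(10-12)[OF that(1)] branch_vert(10-12)[OF that(2)] by simp_all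
  then show "B \<inter> f ` B = {}" "B \<inter> g ` B = {}" "f ` B \<inter> g ` B = {}" by fastforce+
qed

lemma branch_verts_subset: "branch_verts \<subseteq> pverts G - {r}"
proof -
  have "a \<in> pverts G - {r}" "f a \<in> pverts G - {r}" "g a \<in> pverts G - {r}" if "a \<in> B" for a
    using branch_vert[OF that] by simp_all
  then show ?thesis unfolding branch_verts_def by blast
qed

lemma x_notin: "x \<notin> branch_verts"
proof
  assume "x \<in> branch_verts"
  then obtain a where "a \<in> B" "x = a \<or> x = f a \<or> x = g a" unfolding branch_verts_def by blast
  then show False using branch_vert(10-12)[of a] by auto
qed

lemma card_branch_verts: "card branch_verts = 3 * card B"
proof -
  have "card branch_verts = card (B \<union> f ` B) + card (g ` B)"
    unfolding branch_verts_def using finite_B branch_disjoint by (intro card_Un_disjoint) auto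
  also have "card (B \<union> f ` B) = card B + card (f ` B)"
    using finite_B branch_disjoint by (intro card_Un_disjoint) auto
  finally show ?thesis using card_image[OF inj_f] card_image[OF inj_g] by simp
qed

lemma card_verts_trunk: "card (pverts G) = card (pverts trunk) + 3 * card B"
proof -
  have sub: "branch_verts \<subseteq> pverts G" using branch_verts_subset by blast
  then have "card (pverts G - branch_verts) = card (pverts G) - card branch_verts"
    using finite_subset finite_verts by (intro card_Diff_subset) blast+
  then show ?thesis using card_mono[OF finite_verts sub] card_branch_verts unfolding trunk_def by simp
qed

lemma kid_branch:
  assumes "v \<in> pverts G" "v \<noteq> r" "par v \<in> branch_verts"
  shows "v \<in> branch_verts"
proof -
  have k: "v \<in> kids (par v)" using assms kids_iff by simp
  obtain a where a: "a \<in> B" "par v = a \<or> par v = f a \<or> par v = g a" using assms(3) unfolding branch_verts_def by blast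
  then have "v = f a \<or> v = g a" using k branch[OF a(1)] by auto
  then show ?thesis using a(1) unfolding branch_verts_def by blast
qed

lemma trunk_rooted: "rooted_tree trunk r par lev"
  unfolding trunk_def
  using branch_verts_subset root_in_verts par_in_verts kid_branch by (intro induced_rooted_tree) blast+

lemma nbrs_trunk: "v \<in> pverts G - branch_verts \<Longrightarrow> nbrs trunk v = nbrs G v - branch_verts"
  unfolding nbrs_def trunk_def using arcs_in_verts by auto

lemma branch_nbr:
  assumes "v \<in> pverts G - branch_verts" "u \<in> branch_verts" "u \<in> nbrs G v"
  shows "v = x \<and> u \<in> B"
proof -
  have uG: "u \<in> pverts G" "u \<noteq> r" using assms(2) branch_verts_subset by auto
  have "v \<notin> kids u"
  proof
    assume "v \<in> kids u"
    then have "v \<in> pverts G" "v \<noteq> r" "par v = u" unfolding kids_iff by simp_all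
    then show False using kid_branch[of v] assms(1,2) by simp
  qed
  moreover have "v \<in> insert (par u) (kids u)"
    using nbrs_sym[THEN iffD1, OF assms(3)] nbrs_nonroot[OF uG] by simp
  ultimately have p: "par u = v" by blast
  obtain a where a: "a \<in> B" "u = a \<or> u = f a \<or> u = g a" using assms(2) unfolding branch_verts_def by blast
  have "a \<in> branch_verts" "f a \<in> branch_verts" using a(1) unfolding branch_verts_def by auto
  then have "u = a" using a p assms(1) branch_vert[OF a(1)] by auto
  then show ?thesis using a p branch_vert[OF a(1)] by auto
qed

lemma nbrs_trunk_eq: "v \<in> pverts G - branch_verts \<Longrightarrow> v \<noteq> x \<Longrightarrow> nbrs trunk v = nbrs G v"
  using nbrs_trunk branch_nbr by blast

lemma nbrs_trunk_x: "nbrs trunk x = nbrs G x - B"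
  using nbrs_trunk[of x] branch_nbr[of x] x_in_verts x_notin unfolding branch_verts_def by blast

lemma pendants_branch: "pendants G \<inter> branch_verts = g ` B"
proof -
  have "a \<notin> pendants G" "f a \<notin> pendants G" "g a \<in> pendants G" if "a \<in> B" for a
    using pendant_nonroot_iff branch_vert[OF that] branch[OF that] by auto
  then show ?thesis unfolding branch_verts_def by auto
qed

lemma pendant_trunk_iff: "v \<in> pverts trunk \<Longrightarrow> v \<noteq> x \<Longrightarrow> v \<in> pendants trunk \<longleftrightarrow> v \<in> pendants G"
  using nbrs_trunk_eq[of v] unfolding pendants_def by (auto simp: trunk_def)

text \<open>Among the remaining vertices only \<open>x\<close> loses neighbours, so no other vertex
  can become a pendant.\<close>

lemma stems_trunk_subset:
  "stems trunk \<subseteq> (stems G - f ` B) \<union> (if x \<in> pendants trunk then nbrs trunk x else {})"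
proof
  fix s assume "s \<in> stems trunk"
  then obtain u where u: "s \<in> pverts trunk" "u \<in> pendants trunk" "u \<in> nbrs trunk s" unfolding stems_def by auto
  show "s \<in> (stems G - f ` B) \<union> (if x \<in> pendants trunk then nbrs trunk x else {})"
  proof (cases "u = x")
    case True
    then have "s \<in> nbrs trunk x" using u(3) rooted_tree.nbrs_sym[OF trunk_rooted] by blast
    then show ?thesis using u True by simp
  next
    case False
    have uV: "u \<in> pverts trunk" using u(2) unfolding pendants_def by simp
    have "u \<in> nbrs G s" "s \<in> pverts G" using u(1,3) unfolding trunk_def nbrs_def by auto
    moreover have "u \<in> pendants G" using pendant_trunk_iff[OF uV False] u(2) by blast
    ultimately have "s \<in> stems G" unfolding stems_def by blast
    moreover have "s \<notin> f ` B" using u(1) unfolding trunk_def branch_verts_def by auto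
    ultimately show ?thesis by simp
  qed
qed

text \<open>Every branch takes away one pendant and one stem. If \<open>x\<close> turns into a
  pendant, the trunk gains this pendant and at most one stem, its neighbour.\<close>

lemma card_pendants_stems_trunk:
  "card (pendants G) + card (stems trunk) \<le> card (pendants trunk) + card (stems G)"
proof -
  have fin: "finite (pendants G)" "finite (stems G)" "finite (pendants trunk)" "finite (stems trunk)"
    using finite_verts rooted_tree.finite_verts[OF trunk_rooted] unfolding pendants_def stems_def by auto
  let ?P = "pendants G - branch_verts"
  have "card (pendants G) = card ?P + card (pendants G \<inter> branch_verts)"
    using card_Diff_subset_Int[of "pendants G" branch_verts] card_mono[of "pendants G" "pendants G \<inter> branch_verts"] fin(1)
    by simp
  then have l: "card (pendants G) = card ?P + card B" unfolding pendants_branch by (simp add: card_image inj_g)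
  have "f a \<in> stems G" if "a \<in> B" for a
  proof -
    have "g a \<in> nbrs G (f a)" using nbrs_nonroot branch_vert[OF that] branch[OF that] by auto
    then show ?thesis using pendants_branch that branch_vert(4)[OF that] unfolding stems_def by blast
  qed
  then have sub: "f ` B \<subseteq> stems G" by auto
  have s: "card (stems G) = card (stems G - f ` B) + card B"
    using card_Diff_subset[OF _ sub] card_mono[OF fin(2) sub] finite_B by (simp add: card_image inj_f)
  have P: "?P \<subseteq> pendants trunk - {x}"
    using pendant_trunk_iff x_not_pendant unfolding trunk_def pendants_def by auto
  show ?thesis
  proof (cases "x \<in> pendants trunk")
    case True
    then have "card (nbrs trunk x) = 1" unfolding pendants_def by simp
    moreover have "card (stems trunk) \<le> card ((stems G - f ` B) \<union> nbrs trunk x)"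
      using stems_trunk_subset True fin(2) rooted_tree.finite_nbrs[OF trunk_rooted] by (intro card_mono) auto
    moreover have "card ((stems G - f ` B) \<union> nbrs trunk x) \<le> card (stems G - f ` B) + card (nbrs trunk x)"
      by (rule card_Un_le)
    moreover have "card ?P \<le> card (pendants trunk - {x})" using P fin by (intro card_mono) auto
    moreover have "Suc (card (pendants trunk - {x})) = card (pendants trunk)"
      using True fin(3) by (rule card_Suc_Diff1[rotated])
    ultimately show ?thesis using l s by linarith
  next
    case False
    then have "card (stems trunk) \<le> card (stems G - f ` B)"
      using stems_trunk_subset fin(2) by (intro card_mono) auto
    moreover have "card ?P \<le> card (pendants trunk)" using P fin by (intro card_mono) auto
    ultimately show ?thesis using l s by linarith
  qed
qed

lemma edges_trunk: "edges G = edges trunk \<union> (\<Union>a\<in>B. {{a, x}, {f a, a}, {g a, f a}})"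
proof -
  have "pverts G - {r} = (pverts trunk - {r}) \<union> branch_verts"
    using branch_verts_subset unfolding trunk_def by auto
  then have "edges G = edges trunk \<union> (\<lambda>v. {v, par v}) ` branch_verts"
    unfolding edges_eq rooted_tree.edges_eq[OF trunk_rooted] by (simp add: image_Un)
  also have "(\<lambda>v. {v, par v}) ` branch_verts = (\<Union>a\<in>B. {{a, x}, {f a, a}, {g a, f a}})"
    unfolding branch_verts_def by (auto simp: branch_vert)
  finally show ?thesis .
qed

text \<open>A branch is served by the vertices \<open>a\<close> and \<open>f a\<close> and by its
  first and last edge; the one edge that is not chosen joins the two chosen vertices.\<close>

lemma gamma_trunk:
  assumes "pverts trunk \<noteq> {r}"
  shows "gamma_t_oi (subdivision_graph G) \<le> gamma_t_oi (subdivision_graph trunk) + 4 * card B"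
proof -
  obtain D F where DF: "dominating_pair trunk D F"
      "gamma_t_oi (subdivision_graph trunk) = card D + card F"
    using rooted_tree.gamma_attained[OF trunk_rooted assms] .
  let ?D = "D \<union> B \<union> f ` B"
  let ?E1 = "(\<lambda>a. {a, x}) ` B" and ?E2 = "(\<lambda>a. {g a, f a}) ` B"
  have sub: "D \<subseteq> pverts trunk" "F \<subseteq> edges trunk" and cov: "\<And>v. v \<in> pverts trunk \<Longrightarrow> \<exists>e \<in> F. v \<in> e"
    and vc: "\<And>e. e \<in> edges trunk \<Longrightarrow> \<exists>v \<in> D. v \<in> e"
    and ind: "\<And>e. e \<in> edges trunk \<Longrightarrow> e \<notin> F \<Longrightarrow> e \<subseteq> D"
    using DF(1) unfolding dominating_pair_def by auto
  have "dominating_pair G ?D (F \<union> ?E1 \<union> ?E2)"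
    unfolding dominating_pair_def
  proof (intro conjI ballI)
    show "?D \<subseteq> pverts G" using sub(1) branch_vert unfolding trunk_def by auto
    show "F \<union> ?E1 \<union> ?E2 \<subseteq> edges G" using sub(2) unfolding edges_trunk by auto
    show "\<exists>e \<in> F \<union> ?E1 \<union> ?E2. v \<in> e" if "v \<in> pverts G" for v
      using cov[of v] that unfolding trunk_def branch_verts_def by auto
    show "\<exists>v \<in> ?D. v \<in> e" if "e \<in> edges G" for e
      using that vc unfolding edges_trunk by auto
    show "e \<subseteq> ?D" if "e \<in> edges G - (F \<union> ?E1 \<union> ?E2)" for e
      using that ind[of e] unfolding edges_trunk by auto
  qed
  then have "gamma_t_oi (subdivision_graph G) \<le> card ?D + card (F \<union> ?E1 \<union> ?E2)" by (rule gamma_le)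
  also have "card ?D \<le> card D + card B + card (f ` B)"
    by (meson add_le_mono1 card_Un_le le_trans)
  also have "card (F \<union> ?E1 \<union> ?E2) \<le> card F + card ?E1 + card ?E2"
    by (meson add_le_mono1 card_Un_le le_trans)
  also have "card ?E1 \<le> card B" using finite_B by (rule card_image_le)
  also have "card ?E2 \<le> card B" using finite_B by (rule card_image_le)
  also have "card (f ` B) \<le> card B" using finite_B by (rule card_image_le)
  finally show ?thesis using DF(2) by simp
qed

text \<open>A branch has three vertices, which count 12 on the right-hand side, and it raises three
  times the domination number by at most 12. So the trunk is at least as tight as the whole tree,
  and the upper bound for the trunk gives equality.\<close>

lemma tight_trunk:
  assumes "2 \<le> card (pverts trunk)"
    and "3 * gamma_t_oi (subdivision_graph G) + card (pendants G) + 2 = 4 * card (pverts G) + card (stems G)"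
  shows "3 * gamma_t_oi (subdivision_graph trunk) + card (pendants trunk) + 2
    = 4 * card (pverts trunk) + card (stems trunk)"
proof -
  have "pverts trunk \<noteq> {r}" using assms(1) by auto
  then show ?thesis
    using gamma_trunk rooted_tree.upper_bound[OF trunk_rooted assms(1)] assms(2) card_verts_trunk
      card_pendants_stems_trunk
    by linarith
qed

lemma attach_branches:
  assumes "set bs = B"
  shows "foldr (\<lambda>p H. attach_path H x p) (map (\<lambda>a. [a, f a, g a]) bs) trunk = G"
proof (rule pair_pre_digraph.equality)
  have "set (concat (map (\<lambda>a. [a, f a, g a]) bs)) = branch_verts"
    using assms unfolding branch_verts_def by auto
  then show "pverts (foldr (\<lambda>p H. attach_path H x p) (map (\<lambda>a. [a, f a, g a]) bs) trunk) = pverts G"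
    unfolding pverts_foldr_attach_path using branch_verts_subset by (auto simp: trunk_def)
  have P: "parcs (path_graph [a, f a, g a]) = {(a, f a), (f a, a), (f a, g a), (g a, f a)}" for a
    by (auto simp: path_graph_def)
  have arcs: "parcs G = parcs trunk \<union> (\<Union>a\<in>B. {(a, f a), (f a, a), (f a, g a), (g a, f a), (x, a), (a, x)})"
    (is "_ = ?R")
  proof (intro equalityI subrelI)
    fix u v assume uv: "(u, v) \<in> parcs G"
    have *: "(w, par w) \<in> ?R \<and> (par w, w) \<in> ?R" if w: "w \<in> pverts G" "w \<noteq> r" for w
    proof (cases "w \<in> branch_verts")
      case True
      then obtain a where a: "a \<in> B" "w = a \<or> w = f a \<or> w = g a" unfolding branch_verts_def by blast
      let ?S = "{(a, f a), (f a, a), (f a, g a), (g a, f a), (x, a), (a, x)}"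
      have "(w, par w) \<in> ?S \<and> (par w, w) \<in> ?S"
        using a(2) by (elim disjE) (simp_all add: branch_vert(3,6,9)[OF a(1)])
      then show ?thesis using a(1) by blast
    next
      case False
      then have "par w \<notin> branch_verts" using kid_branch[OF w] by blast
      then show ?thesis using w False arc_iff[of w "par w"] arc_iff[of "par w" w] par_in_verts[OF w]
        unfolding trunk_def by simp
    qed
    then show "(u, v) \<in> ?R" using uv arc_iff[of u v] by blast
  next
    fix u v assume "(u, v) \<in> ?R"
    then consider "(u, v) \<in> parcs trunk"
      | a where "a \<in> B" "(u, v) \<in> {(a, f a), (f a, a), (f a, g a), (g a, f a), (x, a), (a, x)}" by blast
    then show "(u, v) \<in> parcs G"
    proof cases
      case 1 then show ?thesis unfolding trunk_def by simp
    next
      case 2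
      have "(w, par w) \<in> parcs G \<and> (par w, w) \<in> parcs G" if "w \<in> {a, f a, g a}" for w
        using that branch_vert[OF 2(1)] arc_iff par_in_verts by blast
      then show ?thesis using 2(2) branch_vert(3,6,9)[OF 2(1)] by (metis insertE insertI1 insertI2 prod.inject singletonD)
    qed
  qed
  then show "parcs (foldr (\<lambda>p H. attach_path H x p) (map (\<lambda>a. [a, f a, g a]) bs) trunk) = parcs G"
    unfolding parcs_foldr_attach_path arcs set_map image_image assms list.sel(1) P
    by (intro arg_cong2[where f = "(\<union>)"] SUP_cong) auto
qed simp

end

section \<open>Copies of the path on three vertices\<close>

lemma image_digraph_iso:
  assumes "pair_wf_digraph T" "inj_on f (pverts T)"
    and "pverts T' = f ` pverts T" "parcs T' = map_prod f f ` parcs T"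
  shows "digraph_iso (with_proj T) (with_proj T')"
proof -
  interpret pair_wf_digraph T by fact
  let ?h = "\<lparr> iso_verts = f, iso_arcs = map_prod f f, iso_head = snd, iso_tail = fst \<rparr>"
  have "inj_on (map_prod f f) (parcs T)"
    using assms(2) in_arcsD1 in_arcsD2 by (auto simp: inj_on_def)
  then have "pre_digraph.digraph_isomorphism (with_proj T) ?h"
    using assms(2) wf_digraph unfolding pre_digraph.digraph_isomorphism_def by simp
  moreover have "with_proj T' = app_iso ?h (with_proj T)"
    using assms(3,4) by (intro pre_digraph.equality) (simp_all add: with_proj_def)
  ultimately show ?thesis unfolding digraph_iso_def by blast
qed

text \<open>The fixed leaf of the path on \<open>v\<close> and \<open>y\<close> may happen to be
  \<open>v\<close>. Then \<open>O1\<close> can attach \<open>z\<close> only to \<open>y\<close>, and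
  the isomorphism exchanging \<open>v\<close> and \<open>y\<close> yields the desired tree.\<close>

lemma three_verts_family:
  assumes T: "pverts T = {v, y, z}" "parcs T = {(v, y), (y, v), (v, z), (z, v)}"
    and d: "distinct [v, y, z]"
  shows "T \<in> tree_family"
proof -
  let ?P = "path_graph [v, y]"
  have P: "?P \<in> tree_family" using d by (intro tree_family.P2) simp
  define u where "u = (SOME u. u \<in> {v, y})"
  have "u \<in> {v, y}" unfolding u_def by (rule someI[of _ v]) simp
  have L: "leaves ?P = {u}" using d unfolding leaves_def path_graph_2_simps u_def by simp
  show ?thesis
  proof (cases "u = y")
    case True
    then have "v \<in> support ?P" using L unfolding support_def nbrs_def path_graph_2_simps by auto
    then have "attach_path ?P v [z] \<in> tree_family"
      using P d by (intro tree_family.O1) (auto simp: path_graph_2_simps)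
    moreover have "attach_path ?P v [z] = T"
      using T by (intro pair_pre_digraph.equality) (auto simp: attach_leaf_simps path_graph_2_simps)
    ultimately show ?thesis by simp
  next
    case False
    then have "u = v" using \<open>u \<in> {v, y}\<close> by simp
    then have "y \<in> support ?P" using L unfolding support_def nbrs_def path_graph_2_simps by auto
    then have H: "attach_path ?P y [z] \<in> tree_family"
      using P d by (intro tree_family.O1) (auto simp: path_graph_2_simps)
    let ?f = "id(v := y, y := v)"
    have "digraph_iso (with_proj (attach_path ?P y [z])) (with_proj T)"
    proof (rule image_digraph_iso)
      show "pair_wf_digraph (attach_path ?P y [z])"
        by unfold_locales (auto simp: attach_leaf_simps path_graph_2_simps)
      show "inj_on ?f (pverts (attach_path ?P y [z]))"
        using d by (auto simp: inj_on_def attach_leaf_simps path_graph_2_simps)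
      show "pverts T = ?f ` pverts (attach_path ?P y [z])"
        unfolding T attach_leaf_simps path_graph_2_simps using d by auto
      show "parcs T = map_prod ?f ?f ` parcs (attach_path ?P y [z])"
        unfolding T attach_leaf_simps path_graph_2_simps using d by auto
    qed
    then show ?thesis using tree_family.iso[OF H] by simp
  qed
qed

section \<open>Removing one of two leaves with a common neighbour\<close>

locale twin_leaves = rooted_tree G r par lev
  for G :: "'a pair_pre_digraph" and r par lev +
  fixes y y' :: 'a
  assumes kids_r: "y \<in> kids r" "y' \<in> kids r" "y \<noteq> y'"
    and leaves_r: "kids y = {}" "kids y' = {}"
begin

definition pruned :: "'a pair_pre_digraph" where "pruned = induced G (pverts G - {y})"

lemma twins: "y \<in> pverts G" "y \<noteq> r" "par y = r" "y' \<in> pverts G" "y' \<noteq> r" "par y' = r"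
  using kids_r unfolding kids_iff by simp_all

lemma nbrs_twins: "nbrs G y = {r}" "nbrs G y' = {r}"
  using nbrs_nonroot twins leaves_r by simp_all

lemma pruned_rooted: "rooted_tree pruned r par lev"
  and attach_pruned: "attach_path pruned r [y] = G"
proof -
  have ny: "par u \<noteq> y" if "u \<in> pverts G" "u \<noteq> r" for u
    using leaves_r(1) that kids_iff[of u y] by auto
  note rem = induced_remove_leaf[OF twins(1,2) ny]
  show "rooted_tree pruned r par lev" unfolding pruned_def using rem(1) by simp
  have "parcs G = parcs pruned \<union> {(r, y), (y, r)}" using rem(2) twins(3) unfolding pruned_def by simp
  moreover have "insert y (pverts pruned) = pverts G" using twins(1) unfolding pruned_def by auto
  ultimately show "attach_path pruned r [y] = G"
    by (intro pair_pre_digraph.equality) (simp_all add: attach_leaf_simps)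
qed

lemma nbrs_pruned: "u \<in> pverts G - {y} \<Longrightarrow> nbrs pruned u = nbrs G u - {y}"
  unfolding nbrs_def pruned_def using arcs_in_verts by auto

lemma nbrs_pruned_eq:
  assumes "u \<in> pverts G" "u \<noteq> y" "u \<noteq> r"
  shows "nbrs pruned u = nbrs G u"
proof -
  have "y \<notin> nbrs G u" using nbrs_twins(1) nbrs_sym[of y u] assms(3) by simp
  then show ?thesis using nbrs_pruned assms by simp
qed

lemma r_not_pendant: "r \<notin> pendants G"
proof
  assume "r \<in> pendants G"
  then have "card (kids r) = 1" using nbrs_root unfolding pendants_def by simp
  then show False using kids_r by (auto simp: card_1_singleton_iff)
qed

lemma twin_pendant_pruned: "y' \<in> pendants pruned" "y' \<in> nbrs pruned r" "r \<in> stems pruned"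
proof -
  have n: "nbrs pruned y' = {r}" using nbrs_pruned_eq nbrs_twins twins kids_r(3) by simp
  then show p: "y' \<in> pendants pruned" using twins kids_r(3) unfolding pendants_def pruned_def by simp
  show "y' \<in> nbrs pruned r" using n rooted_tree.nbrs_sym[OF pruned_rooted, of r y'] by simp
  then show "r \<in> stems pruned" using p root_in_verts twins(2) unfolding stems_def pruned_def by auto
qed

lemma pendants_subset: "pendants G \<subseteq> insert y (pendants pruned)"
proof
  fix u assume u: "u \<in> pendants G"
  then have "u \<in> pverts G" "u \<noteq> r" using r_not_pendant unfolding pendants_def by auto
  then show "u \<in> insert y (pendants pruned)"
    using u nbrs_pruned_eq[of u] unfolding pendants_def pruned_def by auto
qed

text \<open>On two vertices, \<open>r\<close> would itself be a pendant of the pruned tree and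
  \<open>y'\<close> a new stem. With three or more, \<open>r\<close> is not a pendant there, and the
  other remaining vertices keep their neighbours.\<close>

lemma stems_pruned_subset:
  assumes "3 \<le> card (pverts pruned)"
  shows "stems pruned \<subseteq> stems G"
proof
  fix s assume "s \<in> stems pruned"
  then obtain u where u: "s \<in> pverts pruned" "u \<in> pendants pruned" "u \<in> nbrs pruned s"
    unfolding stems_def by auto
  have "u \<noteq> r" using card_verts_gt_2_imp_disjoint[OF pruned_rooted assms] twin_pendant_pruned(3) u(2) by auto
  moreover have "u \<in> pverts G" "u \<noteq> y" using u(2) unfolding pendants_def pruned_def by auto
  ultimately have "u \<in> pendants G" using nbrs_pruned_eq[of u] u(2) unfolding pendants_def by simp
  moreover have "u \<in> nbrs G s" "s \<in> pverts G" using u unfolding pruned_def nbrs_def by auto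
  ultimately show "s \<in> stems G" unfolding stems_def by auto
qed

lemma edges_pruned: "edges G = insert {y, r} (edges pruned)"
proof -
  have "pverts G - {r} = insert y (pverts pruned - {r})" using twins unfolding pruned_def by auto
  then show ?thesis unfolding edges_eq rooted_tree.edges_eq[OF pruned_rooted] using twins(3) by simp
qed

lemma twin_edge_unique: "e \<in> edges pruned \<Longrightarrow> y' \<in> e \<Longrightarrow> r \<in> e"
proof -
  assume e: "e \<in> edges pruned" "y' \<in> e"
  then obtain a b where ab: "e = {a, b}" "(a, b) \<in> parcs pruned" unfolding edges_def by auto
  then have "(a, b) \<in> parcs G" "(b, a) \<in> parcs G" using arcs_sym unfolding pruned_def by auto
  then have "y' = a \<Longrightarrow> b \<in> nbrs G y'" "y' = b \<Longrightarrow> a \<in> nbrs G y'" unfolding nbrs_def by auto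
  then show "r \<in> e" using ab(1) e(2) nbrs_twins(2) by auto
qed

text \<open>If an optimal pair for the pruned tree omits the support vertex, then it contains the leaf
  \<open>y'\<close>, which can be exchanged for the support vertex.\<close>

lemma gamma_pruned: "gamma_t_oi (subdivision_graph G) \<le> Suc (gamma_t_oi (subdivision_graph pruned))"
proof -
  have "pverts pruned \<noteq> {r}" using twins kids_r(3) unfolding pruned_def by auto
  then obtain D F where DF: "dominating_pair pruned D F"
      "gamma_t_oi (subdivision_graph pruned) = card D + card F"
    using rooted_tree.gamma_attained[OF pruned_rooted] by blast
  have sub: "D \<subseteq> pverts pruned" "F \<subseteq> edges pruned" and cov: "\<And>v. v \<in> pverts pruned \<Longrightarrow> \<exists>e \<in> F. v \<in> e"
    and vc: "\<And>e. e \<in> edges pruned \<Longrightarrow> \<exists>v \<in> D. v \<in> e"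
    and ind: "\<And>e. e \<in> edges pruned \<Longrightarrow> e \<notin> F \<Longrightarrow> e \<subseteq> D"
    using DF(1) unfolding dominating_pair_def by auto
  have fin: "finite D" "finite F" using rooted_tree.finite_dominating_pair[OF pruned_rooted DF(1)] by auto
  have "{y', r} \<in> edges pruned"
    using rooted_tree.edge_par[OF pruned_rooted, of y'] twins kids_r(3) unfolding pruned_def by simp
  then have y'r: "y' \<in> D \<or> r \<in> D" using vc by blast
  let ?D = "insert r (if r \<in> D then D else D - {y'})"
  have cD: "card ?D \<le> card D"
  proof (cases "r \<in> D")
    case True then show ?thesis by (simp add: insert_absorb)
  next
    case False
    then have "y' \<in> D" using y'r by simp
    then have "Suc (card (D - {y'})) = card D" using fin(1) by (intro card_Suc_Diff1)
    then show ?thesis using False fin(1) by simp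
  qed
  have "dominating_pair G ?D (insert {y, r} F)"
    unfolding dominating_pair_def
  proof (intro conjI ballI)
    show "?D \<subseteq> pverts G" using sub(1) root_in_verts unfolding pruned_def by auto
    show "insert {y, r} F \<subseteq> edges G" using sub(2) unfolding edges_pruned by auto
    show "\<exists>e \<in> insert {y, r} F. v \<in> e" if "v \<in> pverts G" for v
      using cov[of v] that unfolding pruned_def by auto
    show "\<exists>v \<in> ?D. v \<in> e" if "e \<in> edges G" for e
    proof (cases "r \<in> e")
      case False
      then have "e \<in> edges pruned" "y' \<notin> e" using that twin_edge_unique unfolding edges_pruned by auto
      then show ?thesis using vc[of e] by auto
    qed auto
    show "e \<subseteq> ?D" if "e \<in> edges G - insert {y, r} F" for e
    proof -
      have e: "e \<in> edges pruned" "e \<subseteq> D" using that ind[of e] unfolding edges_pruned by auto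
      show ?thesis
      proof (cases "r \<in> D")
        case False
        then have "y' \<notin> e" using twin_edge_unique e by blast
        then show ?thesis using e(2) False by auto
      qed (use e in auto)
    qed
  qed
  then have "gamma_t_oi (subdivision_graph G) \<le> card ?D + card (insert {y, r} F)" by (rule gamma_le)
  also have "card (insert {y, r} F) \<le> Suc (card F)" using fin by (simp add: card_insert_if)
  finally show ?thesis using DF(2) cD by simp
qed

lemma card_verts_pruned: "card (pverts G) = Suc (card (pverts pruned))"
  unfolding pruned_def using card_Suc_Diff1[OF finite_verts twins(1)] by simp

text \<open>Losing one vertex and at most one pendant, and gaining no stem, lowers
  \<open>4n - l + s\<close> by at least 3, whereas three times the domination number falls by at
  most 3; the upper bound for the pruned tree excludes anything but equality.\<close>

lemma tight_pruned:
  assumes "3 \<le> card (pverts pruned)"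
    and "3 * gamma_t_oi (subdivision_graph G) + card (pendants G) + 2 = 4 * card (pverts G) + card (stems G)"
  shows "3 * gamma_t_oi (subdivision_graph pruned) + card (pendants pruned) + 2
    = 4 * card (pverts pruned) + card (stems pruned)"
proof -
  have fin: "finite (stems G)" "finite (pendants pruned)"
    using finite_verts unfolding stems_def pendants_def pruned_def by auto
  have "card (pendants G) \<le> card (insert y (pendants pruned))"
    using pendants_subset fin by (intro card_mono) auto
  also have "\<dots> \<le> Suc (card (pendants pruned))" using fin by (simp add: card_insert_if)
  finally have "card (pendants G) \<le> Suc (card (pendants pruned))" .
  moreover have "card (stems pruned) \<le> card (stems G)"
    using stems_pruned_subset[OF assms(1)] fin by (intro card_mono)
  moreover have "2 \<le> card (pverts pruned)" using assms(1) by simp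
  ultimately show ?thesis
    using rooted_tree.upper_bound[OF pruned_rooted] assms(2) gamma_pruned card_verts_pruned by linarith
qed

end

subsection \<open>The characterization\<close>

text \<open>The induction is generalized over root, parents and levels because each case works with
  a root of its own: the common neighbour of two leaves, or a stem.\<close>

lemma tight_imp_tree_family:
  assumes "rooted_tree T r par lev" "2 \<le> card (pverts T)"
    and "3 * gamma_t_oi (subdivision_graph T) + card (pendants T) + 2 = 4 * card (pverts T) + card (stems T)"
  shows "T \<in> tree_family"
  using assms
proof (induction "card (pverts T)" arbitrary: T r par lev rule: less_induct)
  case less
  note tight = less.prems(3)
  interpret T0: rooted_tree T r par lev by fact
  show ?case
  proof (cases "card (pverts T) = 2")
    case True
    then show ?thesis using two_verts_family(1)[OF less.prems(1)] by simp
  next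
    case False
    then have n3: "3 \<le> card (pverts T)" using less.prems(2) by simp
    show ?thesis
    proof (cases "\<exists>v y y'. y \<in> pendants T \<and> y' \<in> pendants T \<and> y \<noteq> y' \<and> y \<in> nbrs T v \<and> y' \<in> nbrs T v")
      case True
      then obtain v y y' where y: "y \<in> pendants T" "y' \<in> pendants T" "y \<noteq> y'" "y \<in> nbrs T v" "y' \<in> nbrs T v"
        by blast
      have v: "v \<in> pverts T" using y(4) T0.arcs_in_verts unfolding nbrs_def by auto
      obtain p l where pl: "rooted_tree T v p l" using rooted_tree_reroot[OF less.prems(1) v] by blast
      interpret T: rooted_tree T v p l by fact
      have k: "y \<in> T.kids v" "y' \<in> T.kids v" using y T.nbrs_root by simp_all
      then have yv: "y \<in> pverts T" "y \<noteq> v" "y' \<in> pverts T" "y' \<noteq> v" unfolding T.kids_iff by simp_all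
      then have "T.kids y = {}" "T.kids y' = {}" using y T.pendant_nonroot_iff by auto
      then interpret T: twin_leaves T v p l y y' using k y(3) by unfold_locales
      let ?T = "T.pruned"
      show ?thesis
      \<comment> \<open>With three vertices the pruned tree is a path on two vertices, whose support
        vertex need not be \<open>v\<close>.\<close>
      proof (cases "card (pverts T) = 3")
        case True
        have three: "{v, y, y'} = pverts T"
          using yv v y(3) True T.finite_verts by (intro card_subset_eq) auto
        have n: "nbrs T y = {v}" "nbrs T y' = {v}" by (rule T.nbrs_twins)+
        have "parcs T = {(v, y), (y, v), (v, y'), (y', v)}"
        proof (intro equalityI subrelI)
          fix a b assume ab: "(a, b) \<in> parcs T"
          then have "a \<in> {v, y, y'}" "b \<in> {v, y, y'}" "a \<noteq> b"
            using T.arcs_in_verts T.arcs_loopfree three by auto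
          moreover have "(y, y') \<notin> parcs T" "(y', y) \<notin> parcs T" using n yv unfolding nbrs_def by auto
          ultimately show "(a, b) \<in> {(v, y), (y, v), (v, y'), (y', v)}" using ab by auto
        next
          fix a b assume "(a, b) \<in> {(v, y), (y, v), (v, y'), (y', v)}"
          then show "(a, b) \<in> parcs T" using y(4,5) T.arcs_sym unfolding nbrs_def by auto
        qed
        then show ?thesis using three y(3) yv by (intro three_verts_family[of T v y y']) auto
      next
        case False
        then have n3': "3 \<le> card (pverts ?T)" using n3 T.card_verts_pruned by simp
        then have "?T \<in> tree_family"
          using less.hyps[OF _ T.pruned_rooted _ T.tight_pruned[OF n3' tight]] T.card_verts_pruned by simp
        moreover have "v \<in> support ?T" using support_eq_stems[of ?T] n3' T.twin_pendant_pruned(3) by simp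
        moreover have "y \<notin> pverts ?T" by (simp add: T.pruned_def)
        ultimately have "attach_path ?T v [y] \<in> tree_family" by (rule tree_family.O1)
        then show ?thesis using T.attach_pruned by simp
      qed
    next
      case False
      then have unique: "y = y'"
        if "y \<in> pendants T" "y' \<in> pendants T" "y \<in> nbrs T v" "y' \<in> nbrs T v" for v y y'
        using that by blast
      obtain r' p l where S: "stem_rooted_tree T r' p l" using T0.exists_stem_root[OF n3] by blast
      then interpret T: stem_rooted_tree T r' p l .
      have kid_nbr: "u \<in> nbrs T v" if "u \<in> T.kids v" "v \<in> pverts T" for u v
        using that T.nbrs_root T.nbrs_nonroot[of v] by (cases "v = r'") auto
      have "pverts T \<noteq> {r'}" using n3 by auto
      then obtain c where c: "c \<in> pverts T" "c \<noteq> r'" "\<And>u. u \<in> pverts T \<Longrightarrow> u \<noteq> r' \<Longrightarrow> l u \<le> l c"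
        using T.obtain_deepest by metis
      have deep: "T.kids w = {}" if "w \<in> pverts T" "l w = l c" for w
      proof (rule ccontr)
        assume "T.kids w \<noteq> {}"
        then obtain u where u: "u \<in> T.kids w" by blast
        then have "u \<in> pverts T" "u \<noteq> r'" unfolding T.kids_iff by simp_all
        then show False using c(3)[of u] T.lev_kids[OF u] that(2) by simp
      qed
      \<comment> \<open>The end of a longest path from the root: the leaf \<open>c\<close>, its stem
        \<open>b\<close>, the inner vertex \<open>a\<close> with \<open>b\<close> as its only child,
        and the parent \<open>x\<close> of \<open>a\<close>. The stem \<open>b\<close> is not the
        root, since with the single child \<open>c\<close> it would then be a pendant.\<close>
      define b where "b = p c"
      define a where "a = p b"
      define x where "x = p a"
      have cb: "c \<in> T.kids b" using c T.kids_iff unfolding b_def by simp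
      have bV: "b \<in> pverts T" using T.par_in_verts[OF c(1,2)] unfolding b_def .
      have cP: "c \<in> pendants T" using T.pendant_nonroot_iff[OF c(1,2)] deep[OF c(1)] by simp
      then have bS: "b \<in> stems T" using kid_nbr[OF cb bV] bV unfolding stems_def by blast
      have leaf_kids: "T.kids z = {w}" if "z \<in> pverts T" "w \<in> T.kids z" "l w = l c" for z w
      proof -
        have "u = w" if u: "u \<in> T.kids z" for u
        proof -
          have *: "v \<in> pendants T" if "v \<in> T.kids z" for v
          proof -
            have "v \<in> pverts T" "v \<noteq> r'" using that unfolding T.kids_iff by simp_all
            moreover have "l v = l c"
              using T.lev_kids[OF that] T.lev_kids[OF \<open>w \<in> T.kids z\<close>] \<open>l w = l c\<close> by simp
            ultimately show ?thesis using T.pendant_nonroot_iff deep by blast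
          qed
          show ?thesis
            using unique[OF *[OF u] *[OF \<open>w \<in> T.kids z\<close>] kid_nbr[OF u \<open>z \<in> pverts T\<close>]
                kid_nbr[OF \<open>w \<in> T.kids z\<close> \<open>z \<in> pverts T\<close>]] .
        qed
        then show ?thesis using \<open>w \<in> T.kids z\<close> by blast
      qed
      have kb: "T.kids b = {c}" using leaf_kids[OF bV cb] by simp
      have br: "b \<noteq> r'"
      proof
        assume "b = r'"
        then have "b \<in> pendants T" using kb T.nbrs_root bV unfolding pendants_def by simp
        then show False using bS T.disj by blast
      qed
      have a: "a \<in> T.inner" "T.kids a = {b}" using T.tight_stem[OF tight bS br] unfolding a_def by simp_all
      have aV: "a \<in> pverts T" "a \<noteq> r'" "a \<notin> pendants T" "a \<notin> stems T" using T.inner_kids[OF a(1)] by simp_all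
      have ax: "a \<in> T.kids x" using aV T.kids_iff unfolding x_def by simp
      have xV: "x \<in> pverts T" using T.par_in_verts[OF aV(1,2)] unfolding x_def .
      have xP: "x \<notin> pendants T"
      proof
        assume "x \<in> pendants T"
        then show False using T.pendant_kids ax by blast
      qed
      have lc: "l c = Suc (Suc (Suc (l x)))"
        using T.lev_kids[OF ax] T.lev_kids[of b a] T.lev_kids[OF cb] a(2) by simp
      show ?thesis
      \<comment> \<open>If \<open>x\<close> is a stem, the branch at \<open>a\<close> is removed
        alone and \<open>O2\<close> at \<open>x\<close> restores it. If \<open>x\<close> is inner,
        all branches below it go together, so that \<open>x\<close> becomes a leaf of the
        trunk.\<close>
      proof (cases "x \<in> stems T")
        case True
        interpret B: branched_tree T r' p l x "{a}" "\<lambda>_. b" "\<lambda>_. c"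
          using ax a(2) kb deep[OF c(1)] xV xP by unfold_locales auto
        obtain y where y: "y \<in> pendants T" "y \<in> T.kids x" using T.stem_pendant_kid[OF True] by blast
        have "y \<notin> B.branch_verts"
        proof
          assume "y \<in> B.branch_verts"
          then have "y = c" using y(1) B.pendants_branch by auto
          then have "x = b" using y(2) cb T.kids_iff by auto
          then show False using T.lev_kids[OF cb] lc by simp
        qed
        then have yB: "y \<in> pverts B.trunk" "x \<in> pverts B.trunk" "y \<noteq> x"
          using y xP xV B.x_notin T.pendants_in_verts unfolding B.trunk_def by auto
        have "card {y, x} \<le> card (pverts B.trunk)"
          using yB rooted_tree.finite_verts[OF B.trunk_rooted] by (intro card_mono) auto
        then have n': "2 \<le> card (pverts B.trunk)" using yB by simp
        have lt: "card (pverts B.trunk) < card (pverts T)" using B.card_verts_trunk by simp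
        have F: "B.trunk \<in> tree_family"
          using less.hyps[OF lt B.trunk_rooted n' B.tight_trunk[OF n' tight]] .
        have "x \<in> support B.trunk \<union> weak_leaves B.trunk"
        proof (cases "card (pverts B.trunk) = 2")
          case True then show ?thesis using two_verts_family(2)[OF B.trunk_rooted] yB by simp
        next
          case False
          have "y \<in> pendants B.trunk" using B.pendant_trunk_iff yB y(1) by simp
          moreover have "y \<in> nbrs B.trunk x"
            using kid_nbr[OF y(2) xV] yB unfolding nbrs_def B.trunk_def by simp
          ultimately show ?thesis using support_eq_stems[OF False] yB unfolding stems_def by auto
        qed
        moreover have "distinct [a, b, c]" "set [a, b, c] \<inter> pverts B.trunk = {}"
          using a(2) kb B.branch_disjoint unfolding B.trunk_def B.branch_verts_def by auto
        ultimately have "attach_path B.trunk x [a, b, c] \<in> tree_family"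
          using F by (intro tree_family.O2) auto
        then show ?thesis using B.attach_branches[of "[a]"] by simp
      next
        case False
        then have xI: "x \<in> T.inner" using xV xP unfolding T.inner_def by simp
        have xr: "x \<noteq> r'" using T.inner_kids(2)[OF xI] .
        define f where "f = (\<lambda>y. the_elem (T.kids y))"
        have branch: "T.kids y = {f y} \<and> T.kids (f y) = {f (f y)} \<and> T.kids (f (f y)) = {} \<and> f y \<in> stems T"
          if y: "y \<in> T.kids x" for y
        proof -
          have yV: "y \<in> pverts T" "y \<noteq> r'" "p y = x" using y unfolding T.kids_iff by simp_all
          have "y \<notin> pendants T" using T.inner_kids(4)[OF xI] y by blast
          \<comment> \<open>A stem would be the only child of \<open>x\<close>, hence equal to
            \<open>a\<close>, which is inner.\<close>
          moreover have "y \<notin> stems T"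
          proof
            assume yS: "y \<in> stems T"
            have "a = y" using T.tight_stem(2)[OF tight yS yV(2)] yV(3) ax by simp
            then show False using aV yS by simp
          qed
          ultimately have yI: "y \<in> T.inner" using yV unfolding T.inner_def by simp
          obtain z where z: "z \<in> T.kids y" using T.inner_kids(3)[OF yI] by blast
          then have zV: "z \<in> pverts T" "z \<noteq> r'" "p z = y" unfolding T.kids_iff by simp_all
          have "z \<notin> pendants T" using T.inner_kids(4)[OF yI] z by blast
          \<comment> \<open>This \<open>w\<close> is as deep as \<open>c\<close>, hence a leaf; so
            \<open>z\<close> is a stem and thereby the only child of \<open>y\<close>.\<close>
          then obtain w where w: "w \<in> T.kids z" using T.pendant_nonroot_iff[OF zV(1,2)] by blast
          then have wV: "w \<in> pverts T" "w \<noteq> r'" unfolding T.kids_iff by simp_all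
          have lw: "l w = l c" using lc T.lev_kids[OF y] T.lev_kids[OF z] T.lev_kids[OF w] by simp
          then have kw: "T.kids w = {}" using deep wV by blast
          then have "w \<in> pendants T" using T.pendant_nonroot_iff[OF wV] by simp
          then have zS: "z \<in> stems T" using kid_nbr[OF w zV(1)] zV(1) unfolding stems_def by blast
          have ky: "T.kids y = {z}" using T.tight_stem(2)[OF tight zS zV(2)] zV(3) by simp
          have kz: "T.kids z = {w}" using leaf_kids[OF zV(1) w lw] .
          have "f y = z" "f z = w" unfolding f_def ky kz by simp_all
          then show ?thesis using ky kz kw zS by simp
        qed
        interpret B: branched_tree T r' p l x "T.kids x" f "\<lambda>y. f (f y)"
          using branch xV xP by unfold_locales auto
        \<comment> \<open>Once \<open>q\<close> is known not to be a stem, \<open>x\<close> is the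
          only leaf at \<open>q\<close> in the trunk, hence a weak one. Being inner,
          \<open>q\<close> also has a parent, so the trunk has at least three vertices and the
          convention for two vertices does not matter.\<close>
        define q where "q = p x"
        have qV: "q \<in> pverts T" using T.par_in_verts[OF T.inner_kids(1,2)[OF xI]] unfolding q_def .
        have "q \<notin> stems T"
          using T.tight_no_short_branch[OF tight xI _ ax a(1), of b] a(2) bS unfolding q_def by auto
        moreover have "q \<notin> pendants T" using T.inner_kids(5)[OF xI] unfolding q_def .
        ultimately have qI: "q \<in> T.inner" using qV unfolding T.inner_def by simp
        have qr: "q \<noteq> r'" using T.inner_kids(2)[OF qI] .
        have pqV: "p q \<in> pverts T" using T.par_in_verts[OF qV qr] .
        have lev3: "l x = Suc (l q)" "l q = Suc (l (p q))"
          using T.lev_par[OF T.inner_kids(1,2)[OF xI]] T.lev_par[OF qV qr] unfolding q_def by simp_all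
        have low: "v \<notin> B.branch_verts" if "l v \<le> l x" for v
        proof
          assume "v \<in> B.branch_verts"
          then obtain a where "a \<in> T.kids x" "v = a \<or> v = f a \<or> v = f (f a)"
            unfolding B.branch_verts_def by auto
          then show False using B.branch_vert(10-12)[of a] that by auto
        qed
        have trunk: "x \<in> pverts B.trunk" "q \<in> pverts B.trunk" "p q \<in> pverts B.trunk"
          using low xV qV pqV lev3 unfolding B.trunk_def by simp_all
        have "card {x, q, p q} \<le> card (pverts B.trunk)"
          using trunk rooted_tree.finite_verts[OF B.trunk_rooted] by (intro card_mono) auto
        moreover have "l x \<noteq> l q" "l x \<noteq> l (p q)" "l q \<noteq> l (p q)" unfolding lev3 by simp_all
        then have "x \<noteq> q" "x \<noteq> p q" "q \<noteq> p q" by metis+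
        ultimately have n3': "3 \<le> card (pverts B.trunk)" by simp
        then have n': "2 \<le> card (pverts B.trunk)" by simp
        have kx: "card (T.kids x) > 0" using ax T.finite_kids by (auto simp: card_gt_0_iff)
        have lt: "card (pverts B.trunk) < card (pverts T)" using B.card_verts_trunk kx by simp
        have F: "B.trunk \<in> tree_family"
          using less.hyps[OF lt B.trunk_rooted n' B.tight_trunk[OF n' tight]] .
        have L: "leaves B.trunk = pendants B.trunk" using n3' by (intro leaves_eq_pendants) simp
        have nx: "nbrs B.trunk x = {q}"
          using B.nbrs_trunk_x T.nbrs_nonroot[OF xV xr] T.par_notin_kids[OF xV xr] unfolding q_def by auto
        then have xL: "x \<in> leaves B.trunk" unfolding L pendants_def using trunk by simp
        have "nbrs B.trunk q \<inter> leaves B.trunk \<subseteq> {x}"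
        proof
          fix u assume u: "u \<in> nbrs B.trunk q \<inter> leaves B.trunk"
          show "u \<in> {x}"
          proof (rule ccontr)
            assume "u \<notin> {x}"
            then have "u \<in> pendants T" using u B.pendant_trunk_iff[of u] unfolding L pendants_def by auto
            moreover have "u \<in> nbrs T q" using u unfolding nbrs_def B.trunk_def by auto
            ultimately show False using \<open>q \<notin> stems T\<close> qV unfolding stems_def by auto
          qed
        qed
        then have "card (nbrs B.trunk q \<inter> leaves B.trunk) \<le> 1"
          using card_mono[of "{x}" "nbrs B.trunk q \<inter> leaves B.trunk"] by simp
        then have "q \<notin> strong_support B.trunk" unfolding strong_support_def by simp
        then have weak: "x \<in> weak_leaves B.trunk"
          using xL nx unfolding weak_leaves_def strong_leaves_def by simp
        obtain bs where bs: "set bs = T.kids x" "distinct bs" using finite_distinct_list[OF T.finite_kids] by blast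
        let ?ps = "map (\<lambda>a. [a, f a, f (f a)]) bs"
        let ?Q = "foldr (\<lambda>p H. attach_path H x p) ?ps (path_graph [x])"
        have eq: "foldr (\<lambda>p H. attach_path H x p) ?ps B.trunk = T" using B.attach_branches[OF bs(1)] .
        have cc: "set (concat ?ps) = B.branch_verts" using bs(1) unfolding B.branch_verts_def by auto
        have len: "length bs = card (T.kids x)" using bs distinct_card by metis
        have dist: "distinct (concat ?ps)"
        proof -
          \<comment> \<open>Distinctness is read off from a count: the branches have three vertices
            for every child of \<open>x\<close>.\<close>
          have "card (set (concat ?ps)) = length (concat ?ps)"
            unfolding cc B.card_branch_verts len[symmetric] by (simp add: length_concat o_def sum_list_triv)
          then show ?thesis by (rule card_distinct)
        qed
        show ?thesis
        \<comment> \<open>Since \<open>O3\<close> needs at least two branches, a single branch at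
          the weak leaf \<open>x\<close> is an instance of \<open>O2\<close>.\<close>
        proof (cases "length bs = 1")
          case True
          then obtain d where d: "bs = [d]" by (auto simp: length_Suc_conv)
          have "attach_path B.trunk x [d, f d, f (f d)] \<in> tree_family"
          proof (rule tree_family.O2[OF F])
            show "distinct [d, f d, f (f d)]" using dist d by simp
            show "set [d, f d, f (f d)] \<inter> pverts B.trunk = {}" using cc d unfolding B.trunk_def by auto
          qed (use weak in auto)
          then show ?thesis using eq d by simp
        next
          case False
          then have "2 \<le> length bs" using kx len by simp
          moreover have "is_Q (length bs) x ?Q"
            unfolding is_Q_def
          proof (intro exI[of _ ?ps] conjI)
            show "distinct (x # concat ?ps)" using dist cc B.x_notin by auto
          qed auto
          moreover have "pverts ?Q = insert x B.branch_verts"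
            unfolding pverts_foldr_attach_path cc by (simp add: path_graph_def)
          then have "pverts ?Q \<inter> pverts B.trunk = {x}" using trunk(1) unfolding B.trunk_def by auto
          ultimately have "\<lparr> pverts = pverts B.trunk \<union> pverts ?Q, parcs = parcs B.trunk \<union> parcs ?Q \<rparr> \<in> tree_family"
            by (rule tree_family.O3[OF F weak])
          then show ?thesis unfolding union_attach_paths[OF trunk(1)] eq .
        qed
      qed
    qed
  qed
qed

theorem theorem3p3:
  fixes T :: "'a pair_pre_digraph"
  assumes "is_tree T" and "2 \<le> card (pverts T)"
  shows "real (gamma_t_oi (subdivision_graph T)) =
           (4 * real (card (pverts T)) - real (card (leaves T)) + real (card (support T)) - 2) / 3
         \<longleftrightarrow> T \<in> tree_family"
proof -
  have "pverts T \<noteq> {}" using assms(2) by auto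
  then obtain r where r: "r \<in> pverts T" by blast
  obtain par lev where rt: "rooted_tree T r par lev" using is_tree_rooted_tree[OF assms(1) r] by blast
  interpret rooted_tree T r par lev by fact
  \<comment> \<open>For the path on two vertices, one leaf and one support vertex stand against two
    pendants and two stems; the differences agree.\<close>
  have diff: "real (card (leaves T)) - real (card (support T)) = real (card (pendants T)) - real (card (stems T))"
  proof (cases "card (pverts T) = 2")
    case True
    then show ?thesis using two_verts_family[OF rt] by simp
  next
    case False
    then show ?thesis using leaves_eq_pendants support_eq_stems by metis
  qed
  \<comment> \<open>With the negative terms moved to the other side, the equation lives in the
    natural numbers without truncated subtraction.\<close>
  have of_nat: "3 * gamma_t_oi (subdivision_graph T) + card (pendants T) + 2 = 4 * card (pverts T) + card (stems T)
      \<longleftrightarrow> 3 * real (gamma_t_oi (subdivision_graph T)) + real (card (pendants T)) + 2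
        = 4 * real (card (pverts T)) + real (card (stems T))"
    by linarith
  have "real (gamma_t_oi (subdivision_graph T)) =
      (4 * real (card (pverts T)) - real (card (leaves T)) + real (card (support T)) - 2) / 3 \<longleftrightarrow>
    3 * gamma_t_oi (subdivision_graph T) + card (pendants T) + 2 = 4 * card (pverts T) + card (stems T)"
    unfolding of_nat using diff by (auto simp: field_simps)
  also have "\<dots> \<longleftrightarrow> T \<in> tree_family"
  proof
    assume "T \<in> tree_family"
    then obtain m M A X where "mated_graph T m M A X" using tree_family_mated by blast
    then have "mated_tree T r par lev m M A X" using rt by (simp add: mated_tree_def)
    moreover have "pverts T \<noteq> {r}" using assms(2) by auto
    ultimately show "3 * gamma_t_oi (subdivision_graph T) + card (pendants T) + 2 = 4 * card (pverts T) + card (stems T)"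
      using mated_tree.gamma_lower_bound upper_bound[OF assms(2)] by (metis le_antisym)
  qed (rule tight_imp_tree_family[OF rt assms(2)])
  finally show ?thesis .
qed

end
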